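(* A bipartite graft $(G,T)$ is primal with respect to $r\in V(G)$ if and only if it is a synthesis of a skeleton comb $(G',T';A,B)$ that is primal with respect to $r\in A$ and a set of tooth grafts.
   Context: All graphs are finite (parallel edges allowed). A graft is a pair $(G,T)$ with $T\subseteq V(G)$; a join is $F\subseteq E(G)$ such that each vertex is incident to an odd number of edges of $F$ iff it lies in $T$; a minimum join is one of minimum size. $\delta_G(Y)$: edges with exactly one end in $Y$; $E_G[Y,Z]$: edges joining $Y$ and $Z$. For $F\subseteq E$ and a subgraph $Q$, $w_F(Q)=|E(Q)\setminus F|-|E(Q)\cap F|$; $\lambda_{(G,T),F}(x,y)$ is the minimum of $w_F(P)$ over paths between $x$ and $y$ ($0$ if $x=y$); for a minimum join it does not depend on the choice of $F$. A graft $(H,S)$ is primal with respect to $r\in V(H)$ if $\lambda_{(H,S),F'}(r,x)\le0$ for all $x\in V(H)$ ($F'$ a minimum join); then $A_{(H,S)}(r):=\{x:\lambda_{(H,S),F'}(r,x)=0\}$. A comb $(G',T';A,B)$ is a bipartite graft with color classes $A$ (spine set) and $B$ (tooth set) such that every minimum join $F$ satisfies $|\delta_{G'}(v)\cap F|=1$ for all $v\in B$. Graft contraction: identify a vertex set $Y$ into one vertex (deleting edges inside $Y$), the new vertex being terminal iff $|Y\cap S|$ is odd. Synthesis: given a comb $(G',T';A,B)$ and, for each $v\in B$, a bipartite graft $(G_v,T_v)$ (a tooth graft) with color classes $A_v,B_v$, primal with respect to some $r_v\in A_v$ (all pairwise disjoint and disjoint from $G'$), a bipartite graft $(\hat G,\hat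 T)$ is a synthesis if (1) each $G_v$ is a subgraph of $\hat G$ with the edges of $\hat G$ inside $V(G_v)$ exactly $E(G_v)$ and $\hat T\cap V(G_v)=T_v\Delta\{r_v\}$; (2) contracting each $V(G_v)$ into $v$ yields exactly $(G',T')$; (3) $\delta_{\hat G}(V(G_v))=E_{\hat G}[A,A_{(G_v,T_v)}(r_v)]$. *)

theory Defs
  imports Complex_Main
    "HOL-Library.Extended_Real"
    "HOL-Library.Disjoint_Sets"
    "HOL-Library.Infinite_Typeclass"
begin

section \<open>Finite undirected multigraphs\<close>

text \<open>Edges are names, so that parallel edges are distinct edges with the same set of ends.
  Loops are excluded; all grafts considered are bipartite. The value of \<open>ends\<close> outside
  \<open>edges\<close> carries no information.\<close>

record ('a, 'e) mgraph =
  verts :: "'a set"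
  edges :: "'e set"
  ends :: "'e \<Rightarrow> 'a set"

definition finite_mgraph :: "('a, 'e) mgraph \<Rightarrow> bool" where
  "finite_mgraph G \<longleftrightarrow> finite (verts G) \<and> finite (edges G) \<and>
     (\<forall>e\<in>edges G. ends G e \<subseteq> verts G \<and> card (ends G e) = 2)"

definition same_graph :: "('a, 'e) mgraph \<Rightarrow> ('a, 'e) mgraph \<Rightarrow> bool" where
  "same_graph G H \<longleftrightarrow> verts G = verts H \<and> edges G = edges H \<and>
     (\<forall>e\<in>edges G. ends G e = ends H e)"

definition subgraph :: "('a, 'e) mgraph \<Rightarrow> ('a, 'e) mgraph \<Rightarrow> bool" where
  "subgraph H G \<longleftrightarrow> verts H \<subseteq> verts G \<and> edges H \<subseteq> edges G \<and>
     (\<forall>e\<in>edges H. ends H e = ends G e)"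

text \<open>Colour classes may be empty (a single vertex is a bipartite graph).\<close>

definition colour_classes :: "('a, 'e) mgraph \<Rightarrow> 'a set \<Rightarrow> 'a set \<Rightarrow> bool" where
  "colour_classes G A B \<longleftrightarrow> A \<union> B = verts G \<and> A \<inter> B = {} \<and>
     (\<forall>e\<in>edges G. \<exists>a\<in>A. \<exists>b\<in>B. ends G e = {a, b})"

definition bipartite :: "('a, 'e) mgraph \<Rightarrow> bool" where
  "bipartite G \<longleftrightarrow> (\<exists>A B. colour_classes G A B)"

definition cut :: "('a, 'e) mgraph \<Rightarrow> 'a set \<Rightarrow> 'e set" where
  "cut G Y = {e \<in> edges G. card (ends G e \<inter> Y) = 1}"

definition edges_between :: "('a, 'e) mgraph \<Rightarrow> 'a set \<Rightarrow> 'a set \<Rightarrow> 'e set" where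
  "edges_between G Y Z = {e \<in> edges G. \<exists>y\<in>Y. \<exists>z\<in>Z. ends G e = {y, z}}"

text \<open>A path is given by its vertex sequence \<open>xs\<close> and its edge sequence \<open>es\<close>.\<close>

definition path_between ::
  "('a, 'e) mgraph \<Rightarrow> 'a \<Rightarrow> 'a list \<Rightarrow> 'e list \<Rightarrow> 'a \<Rightarrow> bool" where
  "path_between G x xs es y \<longleftrightarrow>
     length xs = Suc (length es) \<and> hd xs = x \<and> last xs = y \<and>
     distinct xs \<and> set xs \<subseteq> verts G \<and> set es \<subseteq> edges G \<and>
     (\<forall>i<length es. ends G (es ! i) = {xs ! i, xs ! Suc i})"

section \<open>Grafts, joins and distances\<close>

definition graft :: "('a, 'e) mgraph \<Rightarrow> 'a set \<Rightarrow> bool" where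
  "graft G T \<longleftrightarrow> finite_mgraph G \<and> T \<subseteq> verts G"

definition join :: "('a, 'e) mgraph \<Rightarrow> 'a set \<Rightarrow> 'e set \<Rightarrow> bool" where
  "join G T F \<longleftrightarrow> F \<subseteq> edges G \<and>
     (\<forall>v\<in>verts G. odd (card {e \<in> F. v \<in> ends G e}) \<longleftrightarrow> v \<in> T)"

definition minimum_join :: "('a, 'e) mgraph \<Rightarrow> 'a set \<Rightarrow> 'e set \<Rightarrow> bool" where
  "minimum_join G T F \<longleftrightarrow> join G T F \<and> (\<forall>F'. join G T F' \<longrightarrow> card F \<le> card F')"

definition join_weight :: "'e set \<Rightarrow> 'e set \<Rightarrow> int" where
  "join_weight F Q = int (card (Q - F)) - int (card (Q \<inter> F))"

text \<open>Only finitely many paths join two given vertices, so the infimum is a minimum; it is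
  \<open>\<infinity>\<close> if there is no path. For \<open>x = y\<close> only the trivial path remains, which gives \<open>0\<close>.\<close>

definition graft_dist :: "('a, 'e) mgraph \<Rightarrow> 'e set \<Rightarrow> 'a \<Rightarrow> 'a \<Rightarrow> ereal" where
  "graft_dist G F x y =
     Inf {ereal (real_of_int (join_weight F (set es))) | xs es. path_between G x xs es y}"

text \<open>The distance is the same for every minimum join, so it does not matter that a witness
  \<open>F\<close> is chosen existentially. In particular a pair without any join is never primal.\<close>

definition primal :: "('a, 'e) mgraph \<Rightarrow> 'a set \<Rightarrow> 'a \<Rightarrow> bool" where
  "primal G T r \<longleftrightarrow> r \<in> verts G \<and>
     (\<exists>F. minimum_join G T F \<and> (\<forall>x\<in>verts G. graft_dist G F r x \<le> 0))"

definition root_level :: "('a, 'e) mgraph \<Rightarrow> 'a set \<Rightarrow> 'a \<Rightarrow> 'a set" where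
  "root_level G T r =
     {x \<in> verts G. \<exists>F. minimum_join G T F \<and> graft_dist G F r x = 0}"

definition comb :: "('a, 'e) mgraph \<Rightarrow> 'a set \<Rightarrow> 'a set \<Rightarrow> 'a set \<Rightarrow> bool" where
  "comb G T A B \<longleftrightarrow> graft G T \<and> colour_classes G A B \<and>
     (\<forall>F. minimum_join G T F \<longrightarrow> (\<forall>v\<in>B. card (cut G {v} \<inter> F) = 1))"

section \<open>Contraction and synthesis\<close>

text \<open>Simultaneous contraction of pairwise disjoint vertex sets \<open>Y v\<close>, each into the vertex
  \<open>v \<in> B\<close>. It is meaningful only when the vertices in \<open>B\<close> are new, i.e. not in \<open>G\<close>;
  this is required in \<open>synthesis\<close>.\<close>

definition contract_vertex :: "'a set \<Rightarrow> ('a \<Rightarrow> 'a set) \<Rightarrow> 'a \<Rightarrow> 'a" where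
  "contract_vertex B Y x =
     (if \<exists>v\<in>B. x \<in> Y v then THE v. v \<in> B \<and> x \<in> Y v else x)"

definition contract_graph ::
  "('a, 'e) mgraph \<Rightarrow> 'a set \<Rightarrow> ('a \<Rightarrow> 'a set) \<Rightarrow> ('a, 'e) mgraph" where
  "contract_graph G B Y =
     \<lparr> verts = (verts G - (\<Union>v\<in>B. Y v)) \<union> B,
       edges = {e \<in> edges G. \<forall>v\<in>B. \<not> ends G e \<subseteq> Y v},
       ends = (\<lambda>e. contract_vertex B Y ` ends G e) \<rparr>"

definition contract_terminals :: "'a set \<Rightarrow> 'a set \<Rightarrow> ('a \<Rightarrow> 'a set) \<Rightarrow> 'a set" where
  "contract_terminals T B Y =
     (T - (\<Union>v\<in>B. Y v)) \<union> {v \<in> B. odd (card (Y v \<inter> T))}"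

definition tooth_graft :: "('a, 'e) mgraph \<Rightarrow> 'a set \<Rightarrow> 'a \<Rightarrow> bool" where
  "tooth_graft H S s \<longleftrightarrow> graft H S \<and>
     (\<exists>C D. colour_classes H C D \<and> s \<in> C) \<and> primal H S s"

text \<open>\<open>synthesis G T G' T' A B H S s\<close>: the bipartite graft \<open>(G, T)\<close> is a synthesis of the
  comb \<open>(G', T'; A, B)\<close> and the tooth grafts \<open>(H v, S v)\<close> with roots \<open>s v\<close>, for \<open>v \<in> B\<close>.
  Since the vertices in \<open>B\<close> must be new, the vertex type has to be infinite for every primal
  graft to be a synthesis.\<close>

definition synthesis ::
  "('a, 'e) mgraph \<Rightarrow> 'a set \<Rightarrow> ('a, 'e) mgraph \<Rightarrow> 'a set \<Rightarrow> 'a set \<Rightarrow> 'a set \<Rightarrow>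
   ('a \<Rightarrow> ('a, 'e) mgraph) \<Rightarrow> ('a \<Rightarrow> 'a set) \<Rightarrow> ('a \<Rightarrow> 'a) \<Rightarrow> bool" where
  "synthesis G T G' T' A B H S s \<longleftrightarrow>
     comb G' T' A B \<and>
     (\<forall>v\<in>B. tooth_graft (H v) (S v) (s v)) \<and>
     disjoint_family_on (\<lambda>v. verts (H v)) B \<and>
     (\<forall>v\<in>B. verts (H v) \<inter> verts G' = {}) \<and>
     graft G T \<and> bipartite G \<and>
     (\<forall>v\<in>B. subgraph (H v) G \<and>
            edges (H v) = {e \<in> edges G. ends G e \<subseteq> verts (H v)} \<and>
            T \<inter> verts (H v) = sym_diff (S v) {s v}) \<and>
     B \<inter> verts G = {} \<and>
     same_graph (contract_graph G B (\<lambda>v. verts (H v))) G' \<and>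
     contract_terminals T B (\<lambda>v. verts (H v)) = T' \<and>
     (\<forall>v\<in>B. cut G (verts (H v)) = edges_between G A (root_level (H v) (S v) (s v)))"

end

theory Submission
  imports Defs
begin

text \<open>Write \<open>\<tau>(W)\<close> for the minimum size of a \<open>W\<close>-join. In a graft with minimum joins the
  distance from \<open>x\<close> to \<open>y\<close> is \<open>\<tau>(T \<triangle> {x} \<triangle> {y}) - \<tau>(T)\<close>, so with \<open>U = T \<triangle> {r}\<close> everything is
  governed by the levels \<open>\<tau>(U \<triangle> {x})\<close>, and the graft is primal iff \<open>r\<close> has the highest level.
  Identifying a vertex \<open>b\<close> of lowest level with its neighbours lowers all other levels by one;
  by induction this yields Sebo's theorem that a minimum \<open>(U \<triangle> {x})\<close>-join meets the boundary of a
  component \<open>D\<close> of a sublevel set once if \<open>x \<notin> D\<close> and never if \<open>x \<in> D\<close>, and that a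
  \<open>(U \<triangle> W)\<close>-join is at least as large as the highest level if \<open>W\<close> is an odd set of vertices of
  that level. The first statement makes the components below the level of \<open>r\<close> the teeth of a
  synthesis; the second bounds a join of a synthesis from below, tooth by tooth.\<close>

section \<open>Symmetric differences and odd vertices\<close>

text \<open>Measuring against \<open>U\<close> rather than \<open>T\<close> treats all vertices
  alike: a level depends neither on a chosen minimum join nor on the root, so neither has to be
  followed through the contractions. Bipartiteness enters through parity: the colour classes fix the
  size of a \<open>W\<close>-join modulo two, so levels of adjacent vertices differ by exactly one.
  Hence the neighbours of \<open>b\<close> all lie one level above \<open>b\<close>, only edges at
  \<open>b\<close> become loops when they are merged with it, and the outcome is again a bipartite
  graft of the same kind. The obstacle is that a join of the contracted graft need not lift to one
  of the original: its boundary is known only up to an even set of merged vertices. The required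
  inequality therefore comes from exchanges along paths. For a synthesis, the number to aim at is
  \<open>card B\<close> plus the top levels of the teeth: one crossing edge per tooth, and inside a
  tooth the cost of a defect at its top level.\<close>

definition xor_set :: "'a set \<Rightarrow> 'a set \<Rightarrow> 'a set" (infixl "\<triangle>" 65) where
  "A \<triangle> B = sym_diff A B"

lemma in_xor [simp]: "x \<in> A \<triangle> B \<longleftrightarrow> (x \<in> A) \<noteq> (x \<in> B)"
  by (auto simp: xor_set_def)

lemma xor_assoc: "A \<triangle> B \<triangle> C = A \<triangle> (B \<triangle> C)"
  and xor_self [simp]: "A \<triangle> A = {}"
  and xor_empty [simp]: "A \<triangle> {} = A" "{} \<triangle> A = A"
  and xor_cancel [simp]: "A \<triangle> B \<triangle> B = A" "A \<triangle> (A \<triangle> B) = B"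
  by auto

lemma xor_subset: "A \<subseteq> V \<Longrightarrow> B \<subseteq> V \<Longrightarrow> A \<triangle> B \<subseteq> V"
  by auto

lemma xor_Int: "(A \<triangle> B) \<inter> X = (A \<inter> X) \<triangle> (B \<inter> X)"
  by auto

lemma finite_xor [simp]: "finite A \<Longrightarrow> finite B \<Longrightarrow> finite (A \<triangle> B)"
  by (simp add: xor_set_def)

lemma card_xor:
  assumes "finite A" "finite B"
  shows "card (A \<triangle> B) + 2 * card (A \<inter> B) = card A + card B"
proof -
  have "card (A \<triangle> B) = card (A - B) + card (B - A)"
    using assms unfolding xor_set_def by (intro card_Un_disjoint) auto
  moreover have "card A = card (A - B) + card (A \<inter> B)"
    using card_Int_Diff[OF assms(1)] by (simp add: add.commute)
  moreover have "card B = card (B - A) + card (A \<inter> B)"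
    using card_Int_Diff[OF assms(2), of A] by (simp add: Int_commute add.commute)
  ultimately show ?thesis by simp
qed

lemma odd_card_xor:
  assumes "finite A" "finite B"
  shows "odd (card (A \<triangle> B)) \<longleftrightarrow> odd (card A) \<noteq> odd (card B)"
proof -
  have "odd (card (A \<triangle> B) + 2 * card (A \<inter> B)) \<longleftrightarrow> odd (card A + card B)"
    using card_xor[OF assms] by simp
  then show ?thesis by simp
qed

text \<open>Every element of \<open>Q\<close> lies in exactly one of the two sets, so toggling
  \<open>Q\<close> in both moves it from one set to the other. The exchange arguments along paths
  rest on this conservation of total size.\<close>

lemma card_xor_swap:
  assumes "finite A" "finite B" "Q \<subseteq> A \<triangle> B"
  shows "card (A \<triangle> Q) + card (B \<triangle> Q) = card A + card B"
proof -
  have fQ: "finite Q" using assms finite_subset finite_xor by blast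
  have "card Q = card (A \<inter> Q) + card (B \<inter> Q)"
  proof -
    have "Q = (A \<inter> Q) \<union> (B \<inter> Q)" "(A \<inter> Q) \<inter> (B \<inter> Q) = {}" using assms by auto
    then show ?thesis using fQ by (metis card_Un_disjoint finite_Int)
  qed
  with card_xor[OF assms(1) fQ] card_xor[OF assms(2) fQ] show ?thesis by linarith
qed

text \<open>The boundary over the field with two elements. It turns the join condition into the
  equation \<open>odd_verts G J = W\<close> (\<open>join_iff\<close>), and it is additive for
  \<triangle> on finite sets, so the effect of toggling edges is plain algebra.\<close>

definition odd_verts :: "('a, 'e) mgraph \<Rightarrow> 'e set \<Rightarrow> 'a set" where
  "odd_verts G J = {v \<in> verts G. odd (card {e \<in> J. v \<in> ends G e})}"

lemma odd_verts_subset: "odd_verts G J \<subseteq> verts G"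
  by (auto simp: odd_verts_def)

lemma join_iff:
  "W \<subseteq> verts G \<Longrightarrow> join G W J \<longleftrightarrow> J \<subseteq> edges G \<and> odd_verts G J = W"
  by (auto simp: join_def odd_verts_def)

lemma odd_verts_xor:
  assumes "finite J" "finite K"
  shows "odd_verts G (J \<triangle> K) = odd_verts G J \<triangle> odd_verts G K"
proof -
  have "{e \<in> J \<triangle> K. v \<in> ends G e} = {e \<in> J. v \<in> ends G e} \<triangle> {e \<in> K. v \<in> ends G e}" for v
    by auto
  then show ?thesis
    using assms by (auto simp: odd_verts_def odd_card_xor)
qed

lemma odd_verts_empty [simp]: "odd_verts G {} = {}"
  by (auto simp: odd_verts_def)

lemma odd_verts_single:
  assumes "finite_mgraph G" "e \<in> edges G"
  shows "odd_verts G {e} = ends G e"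
proof -
  have "{f \<in> {e}. v \<in> ends G f} = (if v \<in> ends G e then {e} else {})" for v
    by auto
  then show ?thesis using assms by (auto simp: odd_verts_def finite_mgraph_def)
qed

lemma finite_join: "finite_mgraph G \<Longrightarrow> J \<subseteq> edges G \<Longrightarrow> finite J"
  by (auto simp: finite_mgraph_def intro: finite_subset)

lemma odd_verts_toggle:
  assumes "finite_mgraph G" "e \<in> edges G" "J \<subseteq> edges G"
  shows "odd_verts G (J \<triangle> {e}) = odd_verts G J \<triangle> ends G e"
  using assms by (simp add: odd_verts_xor finite_join odd_verts_single)

lemma xor_insert: "e \<notin> J \<Longrightarrow> insert e J = J \<triangle> {e}"
  by auto

lemma cut_subset: "cut G X \<subseteq> edges G"
  by (auto simp: cut_def)

lemma ends_doubleton: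
  assumes "finite_mgraph G" "e \<in> edges G"
  obtains u v where "ends G e = {u, v}" "u \<noteq> v" "u \<in> verts G" "v \<in> verts G"
proof -
  have "card (ends G e) = 2" "ends G e \<subseteq> verts G" using assms by (auto simp: finite_mgraph_def)
  then show thesis using that by (auto simp: card_2_iff)
qed

lemma in_cut_iff:
  assumes "finite_mgraph G" "e \<in> edges G" "ends G e = {u, v}"
  shows "e \<in> cut G X \<longleftrightarrow> (u \<in> X) \<noteq> (v \<in> X)"
proof -
  have "u \<noteq> v" using assms by (auto simp: finite_mgraph_def)
  then show ?thesis
    using assms by (auto simp: cut_def Int_insert_left)
qed

lemma in_cut_single_iff:
  assumes "finite_mgraph G" "e \<in> edges G"
  shows "e \<in> cut G {v} \<longleftrightarrow> v \<in> ends G e"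
proof -
  obtain a b where "ends G e = {a, b}" "a \<noteq> b" using ends_doubleton[OF assms] by metis
  then show ?thesis using in_cut_iff[OF assms] by auto
qed

text \<open>Handshaking, by induction on \<open>J\<close>: one more edge toggles its two ends, which
  changes the parity inside \<open>X\<close> exactly if the edge crosses the border of
  \<open>X\<close>.\<close>

lemma cut_parity:
  assumes "finite_mgraph G" "J \<subseteq> edges G" "finite X"
  shows "odd (card (J \<inter> cut G X)) \<longleftrightarrow> odd (card (odd_verts G J \<inter> X))"
proof -
  have "finite J" using assms finite_join by blast
  then show ?thesis using assms(2)
  proof (induction J rule: finite_induct)
    case empty
    then show ?case by simp
  next
    case (insert e J)
    obtain u v where uv: "ends G e = {u, v}" "u \<noteq> v"
      using ends_doubleton assms(1) insert.prems by (metis insert_subset)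
    have e: "e \<in> edges G" using insert by simp
    have "odd_verts G (J \<triangle> {e}) = odd_verts G J \<triangle> {u, v}"
      using odd_verts_toggle[OF assms(1) e, of J] insert.prems uv by simp
    then have "odd_verts G (insert e J) = odd_verts G J \<triangle> {u, v}"
      using xor_insert[OF insert.hyps(2)] by simp
    then have "odd_verts G (insert e J) \<inter> X = (odd_verts G J \<inter> X) \<triangle> ({u, v} \<inter> X)"
      by (simp only: xor_Int)
    moreover have "odd (card ({u, v} \<inter> X)) \<longleftrightarrow> e \<in> cut G X"
      using in_cut_iff[OF assms(1) e uv(1)] uv(2) by (auto simp: Int_insert_left)
    moreover have "odd (card (insert e J \<inter> cut G X)) \<longleftrightarrow>
        odd (card (J \<inter> cut G X)) \<noteq> (e \<in> cut G X)"
      using insert.hyps by (auto simp: Int_insert_left)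
    ultimately show ?case
      using insert assms(3) by (simp add: odd_card_xor)
  qed
qed

section \<open>Simple paths and joins\<close>

lemma path_snoc:
  assumes "path_between G x xs es u" "e \<in> edges G" "ends G e = {u, v}" "v \<in> verts G" "v \<notin> set xs"
  shows "path_between G x (xs @ [v]) (es @ [e]) v"
proof -
  have "xs \<noteq> []" using assms(1) by (auto simp: path_between_def)
  moreover have "xs ! length es = u"
    using assms(1) last_conv_nth[OF \<open>xs \<noteq> []\<close>] by (auto simp: path_between_def)
  ultimately show ?thesis
    using assms by (auto simp: path_between_def nth_append less_Suc_eq)
qed

lemma path_take:
  assumes "path_between G x xs es y" "i \<le> length es"
  shows "path_between G x (take (Suc i) xs) (take i es) (xs ! i)"
proof -
  have "last (take (Suc i) xs) = xs ! i"
    using assms by (subst take_Suc_conv_app_nth) (auto simp: path_between_def)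
  then show ?thesis
    using assms set_take_subset[of "Suc i" xs] set_take_subset[of i es]
    by (auto simp: path_between_def hd_take)
qed

lemma path_snocE:
  assumes "path_between G x xs (es @ [e]) y"
  obtains ys u where "xs = ys @ [y]" "path_between G x ys es u" "e \<in> edges G" "ends G e = {u, y}"
    "y \<in> verts G" "y \<notin> set ys"
proof -
  have p: "length xs = Suc (Suc (length es))" "last xs = y" "distinct xs" "set xs \<subseteq> verts G"
    "\<And>i. i < Suc (length es) \<Longrightarrow> ends G ((es @ [e]) ! i) = {xs ! i, xs ! Suc i}"
    using assms by (auto simp: path_between_def)
  then have "xs \<noteq> []" by auto
  then have xs: "xs = butlast xs @ [y]" using p by (metis append_butlast_last_id)
  have "path_between G x (take (Suc (length es)) xs) es (xs ! length es)"
    using path_take[OF assms, of "length es"] by simp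
  moreover have "take (Suc (length es)) xs = butlast xs"
    using p by (simp add: butlast_conv_take)
  moreover have "xs ! Suc (length es) = y"
    using p \<open>xs \<noteq> []\<close> by (simp add: last_conv_nth)
  moreover have "ends G e = {xs ! length es, xs ! Suc (length es)}"
    using p(5)[of "length es"] by simp
  moreover have "e \<in> edges G" using assms by (auto simp: path_between_def)
  moreover have "y \<notin> set (butlast xs)" using p(3) xs by (metis distinct_append not_distinct_conv_prefix)
  moreover have "y \<in> verts G" using p(2,4) \<open>xs \<noteq> []\<close> by auto
  ultimately show thesis using that xs by metis
qed

lemma path_edges_touch:
  assumes "path_between G x xs es y" "f \<in> set es"
  shows "ends G f \<subseteq> set xs"
proof -
  obtain i where "i < length es" "f = es ! i" using assms(2) by (auto simp: in_set_conv_nth)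
  then show ?thesis using assms(1) by (auto simp: path_between_def)
qed

lemma path_odd_verts:
  assumes "finite_mgraph G" "path_between G x xs es y"
  shows "odd_verts G (set es) = {x} \<triangle> {y}"
  using assms(2)
proof (induction es arbitrary: xs y rule: rev_induct)
  case Nil
  then have "x = y" by (cases xs) (auto simp: path_between_def)
  then show ?case by simp
next
  case (snoc e es)
  obtain ys u where p: "xs = ys @ [y]" "path_between G x ys es u" "e \<in> edges G" "ends G e = {u, y}"
    "y \<in> verts G" "y \<notin> set ys"
    using path_snocE[OF snoc.prems] by metis
  have "e \<notin> set es"
    using path_edges_touch[OF p(2)] p(4,6) by auto
  then have "set (es @ [e]) = set es \<triangle> {e}" by auto
  moreover have "set es \<subseteq> edges G" using p(2) by (auto simp: path_between_def)
  ultimately have "odd_verts G (set (es @ [e])) = {x} \<triangle> {u} \<triangle> {u, y}"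
    using odd_verts_toggle[OF assms(1) p(3)] snoc.IH[OF p(2)] p(4) by simp
  moreover have "u \<noteq> y"
    using ends_doubleton[OF assms(1) p(3)] p(4) by (metis doubleton_eq_iff)
  then have "{x} \<triangle> {u} \<triangle> {u, y} = {x} \<triangle> {y}" by auto
  ultimately show ?case by simp
qed

lemma path_end_cut:
  assumes "finite_mgraph G" "path_between G x xs es y" "x \<noteq> y"
  shows "card (set es \<inter> cut G {y}) = 1"
proof -
  have "es \<noteq> []" using assms(2,3) by (cases xs) (auto simp: path_between_def)
  then obtain fs e where es: "es = fs @ [e]" by (metis rev_exhaust)
  obtain ys u where p: "xs = ys @ [y]" "path_between G x ys fs u" "e \<in> edges G" "ends G e = {u, y}"
    "y \<in> verts G" "y \<notin> set ys"
    using path_snocE assms(2) unfolding es by metis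
  have "f \<notin> cut G {y}" if "f \<in> set fs" for f
  proof -
    have "f \<in> edges G" using that p(2) by (auto simp: path_between_def)
    then show ?thesis
      using path_edges_touch[OF p(2) that] p(6) in_cut_single_iff[OF assms(1)] by blast
  qed
  moreover have "e \<in> cut G {y}" using in_cut_single_iff[OF assms(1) p(3)] p(4) by simp
  ultimately have "set es \<inter> cut G {y} = {e}" by (auto simp: es)
  then show ?thesis by simp
qed

text \<open>The vertices reachable from \<open>x\<close> inside \<open>J\<close> form a set that no
  edge of \<open>J\<close> leaves. By \<open>cut_parity\<close> it holds an even number of odd
  vertices, so \<open>x\<close> is not the only one.\<close>

lemma path_in_join:
  assumes "finite_mgraph G" "J \<subseteq> edges G" "x \<in> odd_verts G J"
  obtains y xs es where "y \<in> odd_verts G J" "y \<noteq> x" "path_between G x xs es y" "set es \<subseteq> J"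
proof -
  define X where "X = {y. \<exists>xs es. path_between G x xs es y \<and> set es \<subseteq> J}"
  have XV: "X \<subseteq> verts G" by (auto simp: X_def path_between_def) (metis last_in_set length_0_conv nat.distinct(1) subset_iff)
  have fX: "finite X" using XV assms(1) by (auto simp: finite_mgraph_def intro: finite_subset)
  have "x \<in> verts G" using assms(3) odd_verts_subset by fast
  then have "path_between G x [x] [] x" by (auto simp: path_between_def)
  then have xX: "x \<in> X" by (force simp: X_def)
  have step: "v \<in> X" if e: "e \<in> J" "ends G e = {u, v}" "u \<in> X" for e u v
  proof -
    obtain xs es where p: "path_between G x xs es u" "set es \<subseteq> J" using e by (auto simp: X_def)
    show ?thesis
    proof (cases "v \<in> set xs")
      \<comment> \<open>Appending \<open>v\<close> would repeat a vertex; the initial segment ending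
        in \<open>v\<close> is already the path wanted.\<close>
      case True
      then obtain i where i: "i < length xs" "xs ! i = v" by (auto simp: in_set_conv_nth)
      then have "i \<le> length es" using p by (auto simp: path_between_def)
      then have "path_between G x (take (Suc i) xs) (take i es) v" using path_take p i by metis
      moreover have "set (take i es) \<subseteq> J" using p set_take_subset by fastforce
      ultimately show ?thesis by (auto simp: X_def)
    next
      case False
      have "e \<in> edges G" using assms e by auto
      then have "v \<in> verts G" using e(2) assms(1) by (auto simp: finite_mgraph_def)
      have "path_between G x (xs @ [v]) (es @ [e]) v"
        using path_snoc[OF p(1) \<open>e \<in> edges G\<close> e(2) \<open>v \<in> verts G\<close> False] .
      then show ?thesis using p e unfolding X_def by fastforce
    qed
  qed
  have "J \<inter> cut G X = {}"
  proof (rule ccontr)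
    assume "J \<inter> cut G X \<noteq> {}"
    then obtain e where e: "e \<in> J" "e \<in> cut G X" by auto
    then have eE: "e \<in> edges G" using assms(2) by auto
    then obtain u v where uv: "ends G e = {u, v}" using ends_doubleton[OF assms(1)] by metis
    then have "(u \<in> X) \<noteq> (v \<in> X)" using in_cut_iff[OF assms(1) eE uv] e by simp
    moreover have "ends G e = {v, u}" using uv by auto
    ultimately show False using step[OF e(1) uv] step[OF e(1), of v u] by auto
  qed
  then have "even (card (odd_verts G J \<inter> X))"
    using cut_parity[OF assms(1,2) fX] by simp
  then have "odd_verts G J \<inter> X \<noteq> {x}" by auto
  then obtain y where "y \<in> odd_verts G J" "y \<in> X" "y \<noteq> x" using xX assms(3) by blast
  then show thesis using that by (auto simp: X_def)
qed

text \<open>Where no \<open>W\<close>-join exists, the \<open>LEAST\<close> ranges over nothing and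
  the number is arbitrary. Existence of joins is therefore carried along separately, as in
  \<open>primal_iff\<close> and \<open>rooted\<close>.\<close>

definition tau :: "('a, 'e) mgraph \<Rightarrow> 'a set \<Rightarrow> nat" where
  "tau G W = (LEAST n. \<exists>J. join G W J \<and> card J = n)"

lemma tau_le: "join G W J \<Longrightarrow> tau G W \<le> card J"
  unfolding tau_def by (rule Least_le) auto

lemma tau_attained:
  assumes "join G W J"
  obtains K where "join G W K" "card K = tau G W"
proof -
  have "\<exists>K. join G W K \<and> card K = tau G W"
    unfolding tau_def by (rule LeastI_ex) (use assms in auto)
  then show thesis using that by auto
qed

lemma minimum_join_iff: "minimum_join G W J \<longleftrightarrow> join G W J \<and> card J = tau G W"
  unfolding minimum_join_def by (metis le_antisym tau_attained tau_le)

lemma join_weight_xor: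
  assumes "finite F" "finite P"
  shows "int (card (F \<triangle> P)) = int (card F) + join_weight F P"
proof -
  have "card P = card (P - F) + card (P \<inter> F)"
    using card_Int_Diff[OF assms(2), of F] by simp
  with card_xor[OF assms] show ?thesis
    by (simp add: join_weight_def Int_commute)
qed

text \<open>Toggling a path in \<open>F\<close> moves the terminals by its two ends and changes the
  size by the weight of the path. Conversely, a join \<open>J\<close> for the shifted terminals
  yields a path inside \<open>F \<triangle> J\<close>. Using an upper bound \<open>k\<close> in
  place of the value avoids treating infinity: without a path both sides are false.\<close>

lemma graft_dist_le_iff:
  assumes "graft G T" "minimum_join G T F" "x \<in> verts G" "y \<in> verts G"
  shows "graft_dist G F x y \<le> ereal (real_of_int k) \<longleftrightarrow>
    (\<exists>J. join G (T \<triangle> {x} \<triangle> {y}) J \<and> int (card J) \<le> int (tau G T) + k)"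
    (is "?L \<longleftrightarrow> ?R")
proof -
  have G: "finite_mgraph G" "T \<subseteq> verts G" using assms by (auto simp: graft_def)
  have F: "F \<subseteq> edges G" "odd_verts G F = T" "card F = tau G T"
    using assms(2) join_iff[OF G(2)] by (auto simp: minimum_join_iff)
  have fF: "finite F" using finite_join[OF G(1) F(1)] .
  have sub: "T \<triangle> {x} \<triangle> {y} \<subseteq> verts G" using G assms by auto
  have path: "?L \<longleftrightarrow> (\<exists>xs es. path_between G x xs es y \<and> join_weight F (set es) \<le> k)"
  proof
    assume ?L
    \<comment> \<open>Weights are integers, so a strict bound by \<open>k + 1\<close> produces a
      single path of weight at most \<open>k\<close>, without a proof that the infimum is
      attained.\<close>
    then have "graft_dist G F x y < ereal (real_of_int (k + 1))"
      using le_less_trans by (metis ereal_less_eq(3) less_ereal.simps(1) not_less of_int_less_iff zle_add1_eq_le order_refl)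
    then show "\<exists>xs es. path_between G x xs es y \<and> join_weight F (set es) \<le> k"
      by (auto simp: graft_dist_def Inf_less_iff) (metis of_int_1 of_int_add of_int_less_iff zle_add1_eq_le)
  next
    assume "\<exists>xs es. path_between G x xs es y \<and> join_weight F (set es) \<le> k"
    then obtain xs es where p: "path_between G x xs es y" "join_weight F (set es) \<le> k" by auto
    then have "graft_dist G F x y \<le> ereal (real_of_int (join_weight F (set es)))"
      unfolding graft_dist_def by (intro Inf_lower) auto
    also have "\<dots> \<le> ereal (real_of_int k)" using p by simp
    finally show ?L .
  qed
  show ?thesis unfolding path
  proof
    assume "\<exists>xs es. path_between G x xs es y \<and> join_weight F (set es) \<le> k"
    then obtain xs es where p: "path_between G x xs es y" "join_weight F (set es) \<le> k" by auto
    have "set es \<subseteq> edges G" using p by (auto simp: path_between_def)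
    then have "F \<triangle> set es \<subseteq> edges G" using F by auto
    then have "join G (T \<triangle> {x} \<triangle> {y}) (F \<triangle> set es)"
      using F path_odd_verts[OF G(1) p(1)] fF
      by (simp add: join_iff[OF sub] odd_verts_xor xor_assoc[symmetric])
    moreover have "int (card (F \<triangle> set es)) \<le> int (tau G T) + k"
      using join_weight_xor[OF fF] p F by simp
    ultimately show ?R by blast
  next
    assume ?R
    then obtain J where J: "J \<subseteq> edges G" "odd_verts G J = T \<triangle> {x} \<triangle> {y}" "int (card J) \<le> int (tau G T) + k"
      using join_iff[OF sub] by auto
    have fJ: "finite J" using finite_join[OF G(1) J(1)] .
    show "\<exists>xs es. path_between G x xs es y \<and> join_weight F (set es) \<le> k"
    proof (cases "x = y")
      case True
      then have "join G T J" using J by (auto simp: join_iff[OF G(2)])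
      then have "0 \<le> k" using tau_le[of G T J] J(3) by linarith
      moreover have "path_between G x [x] [] y" using True assms by (auto simp: path_between_def)
      ultimately show ?thesis by (intro exI[of _ "[x]"] exI[of _ "[]"]) (auto simp: join_weight_def)
    next
      case False
      have odd: "odd_verts G (F \<triangle> J) = {x, y}"
        using F J fF fJ False by (auto simp: odd_verts_xor)
      obtain y' xs es where p: "y' \<in> odd_verts G (F \<triangle> J)" "y' \<noteq> x" "path_between G x xs es y'" "set es \<subseteq> F \<triangle> J"
        using path_in_join[OF G(1) xor_subset[OF F(1) J(1)], of x] odd by auto
      have y: "y' = y" using p odd by auto
      let ?Q = "set es"
      have QE: "?Q \<subseteq> edges G" using order_trans[OF p(4) xor_subset[OF F(1) J(1)]] .
      have "odd_verts G (J \<triangle> ?Q) = T"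
        using J path_odd_verts[OF G(1) p(3)] fJ by (auto simp: odd_verts_xor y)
      \<comment> \<open>Exchanging along \<open>?Q\<close> makes \<open>J\<close> a
        \<open>T\<close>-join, hence at least as large as the minimum join \<open>F\<close>. The
        total size is kept, so \<open>F \<triangle> ?Q\<close> is at most as large as
        \<open>J\<close>.\<close>
      then have "join G T (J \<triangle> ?Q)" using J(1) QE by (auto simp: join_iff[OF G(2)])
      then have "tau G T \<le> card (J \<triangle> ?Q)" by (rule tau_le)
      then have "card (F \<triangle> ?Q) \<le> card J"
        using card_xor_swap[OF fF fJ p(4)] F(3) by linarith
      then have "join_weight F ?Q \<le> k"
        using join_weight_xor[OF fF, of ?Q] J(3) F(3) by simp
      then show ?thesis using p(3) y by blast
    qed
  qed
qed

lemma tau_le_iff: "(\<exists>J. join G W J \<and> card J \<le> n) \<longleftrightarrow> (\<exists>J. join G W J) \<and> tau G W \<le> n"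
  by (metis le_trans tau_attained tau_le le_refl)

lemma primal_iff:
  assumes "graft G T"
  shows "primal G T r \<longleftrightarrow> r \<in> verts G \<and>
    (\<forall>x\<in>verts G. \<exists>J. join G (T \<triangle> {r} \<triangle> {x}) J \<and> card J \<le> tau G T)"
proof -
  have le: "graft_dist G F r x \<le> 0 \<longleftrightarrow> (\<exists>J. join G (T \<triangle> {r} \<triangle> {x}) J \<and> card J \<le> tau G T)"
    if "minimum_join G T F" "r \<in> verts G" "x \<in> verts G" for F x
    using graft_dist_le_iff[OF assms that(1-3), of 0] by (simp add: zero_ereal_def)
  show ?thesis
  proof
    assume "primal G T r"
    then show "r \<in> verts G \<and> (\<forall>x\<in>verts G. \<exists>J. join G (T \<triangle> {r} \<triangle> {x}) J \<and> card J \<le> tau G T)"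
      using le by (auto simp: primal_def)
  next
    assume *: "r \<in> verts G \<and> (\<forall>x\<in>verts G. \<exists>J. join G (T \<triangle> {r} \<triangle> {x}) J \<and> card J \<le> tau G T)"
    \<comment> \<open>The instance \<open>x = r\<close> provides a \<open>T\<close>-join, so a
      minimum join exists.\<close>
    then have "\<exists>J. join G T J" by (metis xor_cancel(1))
    then obtain F where "minimum_join G T F" by (metis minimum_join_iff tau_attained)
    then show "primal G T r" using * le unfolding primal_def by metis
  qed
qed

text \<open>Distances from the root are at most zero here, and being infima of integers they are
  zero unless they are at most -1. Both thresholds are covered by
  \<open>graft_dist_le_iff\<close>.\<close>

lemma root_level_eq:
  assumes "graft G T" "primal G T r"
  shows "root_level G T r = {x \<in> verts G. tau G (T \<triangle> {r} \<triangle> {x}) = tau G T}"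
proof -
  have r: "r \<in> verts G" and ex: "\<And>x. x \<in> verts G \<Longrightarrow> \<exists>J. join G (T \<triangle> {r} \<triangle> {x}) J"
    and up: "\<And>x. x \<in> verts G \<Longrightarrow> tau G (T \<triangle> {r} \<triangle> {x}) \<le> tau G T"
    using assms primal_iff[OF assms(1)] tau_le_iff by blast+
  have "graft_dist G F r x = 0 \<longleftrightarrow> tau G (T \<triangle> {r} \<triangle> {x}) = tau G T"
    if m: "minimum_join G T F" and x: "x \<in> verts G" for F x
  proof -
    have zero: "graft_dist G F r x \<le> 0"
      using graft_dist_le_iff[OF assms(1) m r x, of 0] up[OF x] ex[OF x]
        tau_le_iff[of G "T \<triangle> {r} \<triangle> {x}" "tau G T"]
      by (simp add: zero_ereal_def)
    have "graft_dist G F r x \<le> ereal (real_of_int (-1)) \<longleftrightarrow> tau G (T \<triangle> {r} \<triangle> {x}) < tau G T"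
    proof -
      have "(\<exists>J. join G (T \<triangle> {r} \<triangle> {x}) J \<and> int (card J) \<le> int (tau G T) + -1) \<longleftrightarrow>
        tau G (T \<triangle> {r} \<triangle> {x}) < tau G T" (is "?A \<longleftrightarrow> ?B")
      proof
        assume ?A
        then show ?B using tau_le by fastforce
      next
        assume ?B
        obtain K where "join G (T \<triangle> {r} \<triangle> {x}) K" "card K = tau G (T \<triangle> {r} \<triangle> {x})"
          using ex[OF x] tau_attained by metis
        with \<open>?B\<close> show ?A by (intro exI[of _ K]) simp
      qed
      then show ?thesis using graft_dist_le_iff[OF assms(1) m r x, of "-1"] by simp
    qed
    moreover have "graft_dist G F r x = 0 \<longleftrightarrow> \<not> graft_dist G F r x \<le> ereal (real_of_int (-1))"
    proof
      assume "\<not> graft_dist G F r x \<le> ereal (real_of_int (-1))"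
      moreover have "graft_dist G F r x \<le> ereal (real_of_int (-1))" if lt: "graft_dist G F r x < 0"
      proof -
        obtain xs es where p: "path_between G r xs es x" "real_of_int (join_weight F (set es)) < 0"
          using lt by (auto simp: graft_dist_def Inf_less_iff)
        then have "join_weight F (set es) \<le> -1" by simp
        then have "real_of_int (join_weight F (set es)) \<le> real_of_int (-1)"
          by (simp only: of_int_le_iff)
        moreover have "graft_dist G F r x \<le> ereal (real_of_int (join_weight F (set es)))"
          unfolding graft_dist_def using p by (intro Inf_lower) auto
        ultimately show ?thesis by (metis ereal_less_eq(3) order_trans)
      qed
      ultimately show "graft_dist G F r x = 0" using zero by (metis order_le_less)
    qed (simp add: zero_ereal_def)
    ultimately show ?thesis using up[OF x] by auto
  qed
  moreover have "\<exists>F. minimum_join G T F" using assms(2) by (auto simp: primal_def)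
  ultimately show ?thesis by (auto simp: root_level_def)
qed

section \<open>Levels of a rooted graft\<close>

text \<open>Every edge crosses from \<open>A\<close> to \<open>B\<close>, so all of \<open>J\<close>
  lies in \<open>cut G A\<close>, and \<open>cut_parity\<close> for \<open>A\<close> counts
  \<open>J\<close> itself.\<close>

lemma join_parity:
  assumes "finite_mgraph G" "colour_classes G A B" "W \<subseteq> verts G" "join G W J"
  shows "odd (card J) \<longleftrightarrow> odd (card (W \<inter> A))"
proof -
  have J: "J \<subseteq> edges G" "odd_verts G J = W" using assms by (auto simp: join_iff)
  have "e \<in> cut G A" if e: "e \<in> J" for e
  proof -
    have eE: "e \<in> edges G" using e J by auto
    then obtain a b where "a \<in> A" "b \<in> B" "ends G e = {a, b}"
      using assms(2) by (auto simp: colour_classes_def)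
    moreover have "b \<notin> A" using \<open>b \<in> B\<close> assms(2) by (auto simp: colour_classes_def)
    ultimately show ?thesis using in_cut_iff[OF assms(1) eE] by simp
  qed
  then have "J \<inter> cut G A = J" by auto
  moreover have "finite A" using assms(1,2) by (auto simp: finite_mgraph_def colour_classes_def intro: finite_subset)
  ultimately show ?thesis using cut_parity[OF assms(1) J(1)] J(2) by metis
qed

text \<open>What is kept of a primal graft with \<open>U = T \<triangle> {r}\<close>: the joins
  behind all levels exist. No root is recorded, which is what lets the property pass to
  contractions.\<close>

definition rooted :: "('a, 'e) mgraph \<Rightarrow> 'a set \<Rightarrow> bool" where
  "rooted G U \<longleftrightarrow> finite_mgraph G \<and> bipartite G \<and> U \<subseteq> verts G \<and>
     (\<forall>x\<in>verts G. \<exists>J. join G (U \<triangle> {x}) J)"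

definition lev :: "('a, 'e) mgraph \<Rightarrow> 'a set \<Rightarrow> 'a \<Rightarrow> nat" where
  "lev G U x = tau G (U \<triangle> {x})"

lemma lev_le: "join G (U \<triangle> {x}) J \<Longrightarrow> lev G U x \<le> card J"
  unfolding lev_def by (rule tau_le)

lemma lev_attained:
  assumes "rooted G U" "x \<in> verts G"
  obtains J where "join G (U \<triangle> {x}) J" "card J = lev G U x"
  using assms unfolding rooted_def lev_def by (metis tau_attained)

lemma rooted_join_iff:
  assumes "rooted G U" "x \<in> verts G"
  shows "join G (U \<triangle> {x}) J \<longleftrightarrow> J \<subseteq> edges G \<and> odd_verts G J = U \<triangle> {x}"
  using assms by (intro join_iff) (auto simp: rooted_def)

lemma join_shift:
  assumes "finite_mgraph G" "U \<subseteq> verts G" "join G (U \<triangle> {u}) J" "e \<in> edges G" "ends G e = {u, v}"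
  shows "join G (U \<triangle> {v}) (J \<triangle> {e})"
proof -
  have uv: "u \<in> verts G" "v \<in> verts G" "u \<noteq> v"
    using assms(1,4,5) by (auto simp: finite_mgraph_def)
  have sub: "U \<triangle> {u} \<subseteq> verts G" "U \<triangle> {v} \<subseteq> verts G" using uv assms(2) by auto
  have J: "J \<subseteq> edges G" "odd_verts G J = U \<triangle> {u}" using assms(3) by (auto simp: join_iff[OF sub(1)])
  have "U \<triangle> {u} \<triangle> {u, v} = U \<triangle> {v}" using uv by auto
  then have "odd_verts G (J \<triangle> {e}) = U \<triangle> {v}"
    using odd_verts_toggle[OF assms(1,4) J(1)] J(2) assms(5) by simp
  then show ?thesis using J(1) assms(4) by (auto simp: join_iff[OF sub(2)])
qed

lemma card_toggle_le: "finite J \<Longrightarrow> card (J \<triangle> {e}) \<le> Suc (card J)"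
  using card_xor[of J "{e}"] by simp

lemma card_toggle_in: "finite J \<Longrightarrow> e \<in> J \<Longrightarrow> Suc (card (J \<triangle> {e})) = card J"
  using card_xor[of J "{e}"] by simp

text \<open>Toggling the edge turns a minimum join for one end into a join for the other, so the
  levels differ by at most one. The ends lie in different colour classes, so by
  \<open>join_parity\<close> the levels are not equal.\<close>

lemma lev_adjacent:
  assumes "rooted G U" "e \<in> edges G" "ends G e = {u, v}"
  shows "lev G U u = Suc (lev G U v) \<or> lev G U v = Suc (lev G U u)"
proof -
  have G: "finite_mgraph G" "U \<subseteq> verts G" using assms by (auto simp: rooted_def)
  obtain A B where AB: "colour_classes G A B" using assms by (auto simp: rooted_def bipartite_def)
  have uv: "u \<in> verts G" "v \<in> verts G" "u \<noteq> v"
    using G(1) assms(2,3) by (auto simp: finite_mgraph_def)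
  have le: "lev G U y \<le> Suc (lev G U x)" if "ends G e = {x, y}" "x \<in> verts G" for x y
  proof -
    obtain J where J: "join G (U \<triangle> {x}) J" "card J = lev G U x"
      using lev_attained[OF assms(1) \<open>x \<in> verts G\<close>] by metis
    have "finite J" using J(1) finite_join[OF G(1)] by (auto simp: join_def)
    then show ?thesis
      using lev_le[OF join_shift[OF G J(1) assms(2) that(1)]] card_toggle_le[of J e] J(2) by linarith
  qed
  have par: "odd (lev G U x) \<longleftrightarrow> odd (card ((U \<inter> A) \<triangle> ({x} \<inter> A)))" if "x \<in> verts G" for x
  proof -
    obtain J where J: "join G (U \<triangle> {x}) J" "card J = lev G U x"
      using lev_attained[OF assms(1) \<open>x \<in> verts G\<close>] by metis
    have "U \<triangle> {x} \<subseteq> verts G" using G that by auto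
    then show ?thesis using join_parity[OF G(1) AB _ J(1)] J(2) by (simp add: xor_Int)
  qed
  have f: "finite (U \<inter> A)" using G by (auto simp: finite_mgraph_def intro: finite_subset)
  have "(u \<in> A) \<noteq> (v \<in> A)"
  proof -
    obtain a b where "a \<in> A" "b \<in> B" "{u, v} = {a, b}"
      using AB assms(2,3) unfolding colour_classes_def by metis
    moreover have "A \<inter> B = {}" using AB by (simp add: colour_classes_def)
    ultimately show ?thesis by (auto simp: doubleton_eq_iff)
  qed
  then have "odd (lev G U u) \<noteq> odd (lev G U v)"
    using par[OF uv(1)] par[OF uv(2)] f by (auto simp: odd_card_xor)
  moreover have "lev G U v \<le> Suc (lev G U u)" "lev G U u \<le> Suc (lev G U v)"
    using le[of u v] le[of v u] assms(3) uv by (auto simp: insert_commute)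
  ultimately show ?thesis
    by (metis le_SucE le_antisym not_less_eq_eq)
qed

section \<open>Minimum joins seen from a vertex of lowest level\<close>

locale level_min =
  fixes G :: "('a, 'e) mgraph" and U :: "'a set" and b :: 'a
  assumes rooted: "rooted G U" and bV: "b \<in> verts G"
    and lev_min: "x \<in> verts G \<Longrightarrow> lev G U b \<le> lev G U x"
begin

lemma graph: "finite_mgraph G" "U \<subseteq> verts G"
  using rooted by (auto simp: rooted_def)

lemma finV: "finite (verts G)"
  using graph by (auto simp: finite_mgraph_def)

lemma bjoin_iff: "x \<in> verts G \<Longrightarrow> join G (U \<triangle> {x}) J \<longleftrightarrow> J \<subseteq> edges G \<and> odd_verts G J = U \<triangle> {x}"
  by (rule rooted_join_iff[OF rooted])

lemma cut_bE:
  assumes "e \<in> cut G {b}"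
  obtains c where "ends G e = {b, c}" "c \<noteq> b" "c \<in> verts G" "e \<in> edges G"
proof -
  have e: "e \<in> edges G" using assms cut_subset by fast
  then obtain u v where uv: "ends G e = {u, v}" "u \<noteq> v" "u \<in> verts G" "v \<in> verts G"
    using ends_doubleton[OF graph(1)] by metis
  have "b = u \<or> b = v" using in_cut_single_iff[OF graph(1) e, of b] assms uv by auto
  then show thesis using that uv e by (metis insert_commute)
qed

text \<open>Dropping an edge of \<open>J\<close> at \<open>b\<close> would leave a smaller join for
  the neighbour, although no level is lower than that of \<open>b\<close>.\<close>

lemma min_join_b:
  assumes "join G (U \<triangle> {b}) J" "card J = lev G U b"
  shows "J \<inter> cut G {b} = {}"
proof (rule ccontr)
  assume "J \<inter> cut G {b} \<noteq> {}"
  then obtain e where e: "e \<in> J" "e \<in> cut G {b}" by auto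
  then obtain c where c: "ends G e = {b, c}" "c \<in> verts G" "e \<in> edges G" using cut_bE by metis
  have "finite J" using assms(1) finite_join[OF graph(1)] by (auto simp: join_def)
  then have "lev G U c < card J"
    using lev_le[OF join_shift[OF graph assms(1) c(3,1)]] card_toggle_in[of J e] e(1) by linarith
  then show False using lev_min[OF c(2)] assms(2) by linarith
qed

text \<open>A minimum join for \<open>b\<close> has no edge at \<open>b\<close>, so \<open>b\<close>
  is not in \<open>U \<triangle> {b}\<close>. This parity later forces an edge at \<open>b\<close>
  into joins that need not be minimum.\<close>

lemma b_in_U: "b \<in> U"
proof -
  obtain J where J: "join G (U \<triangle> {b}) J" "card J = lev G U b"
    using lev_attained[OF rooted bV] by metis
  have "J \<subseteq> edges G" "odd_verts G J = U \<triangle> {b}" using J(1) bjoin_iff[OF bV] by auto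
  then have "even (card ((U \<triangle> {b}) \<inter> {b}))"
    using cut_parity[OF graph(1), of J "{b}"] min_join_b[OF J] by simp
  then show ?thesis by (cases "b \<in> U") (auto simp: xor_Int)
qed

text \<open>\<open>J\<close> and a minimum join \<open>K\<close> for \<open>b\<close> differ along a
  path from \<open>x\<close> to \<open>b\<close>. Exchanging it keeps the total size, so both
  results are minimum again, with the roles of \<open>x\<close> and \<open>b\<close> swapped. The
  one for \<open>b\<close> has no edge at \<open>b\<close>, so \<open>J\<close> and the path agree
  at \<open>b\<close>, where the path ends with a single edge.\<close>

lemma min_join_card:
  assumes "x \<in> verts G" "x \<noteq> b" "join G (U \<triangle> {x}) J" "card J = lev G U x"
  shows "card (J \<inter> cut G {b}) = 1"
proof -
  obtain K where K: "join G (U \<triangle> {b}) K" "card K = lev G U b"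
    using lev_attained[OF rooted bV] by metis
  have J': "J \<subseteq> edges G" "odd_verts G J = U \<triangle> {x}" using assms bjoin_iff by auto
  have K': "K \<subseteq> edges G" "odd_verts G K = U \<triangle> {b}" using K(1) bjoin_iff[OF bV] by auto
  have fin: "finite J" "finite K" using J' K' finite_join[OF graph(1)] by auto
  have "U \<triangle> {x} \<triangle> (U \<triangle> {b}) = {x, b}" using assms(2) by auto
  then have odd: "odd_verts G (J \<triangle> K) = {x, b}" using J' K' fin by (simp add: odd_verts_xor)
  obtain y xs es where p: "y \<in> odd_verts G (J \<triangle> K)" "y \<noteq> x" "path_between G x xs es y" "set es \<subseteq> J \<triangle> K"
    using path_in_join[OF graph(1) xor_subset[OF J'(1) K'(1)], of x] odd by auto
  let ?Q = "set es"
  have y: "y = b" using p(1,2) odd by auto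
  have Q: "odd_verts G ?Q = {x} \<triangle> {b}" using path_odd_verts[OF graph(1) p(3)] y by simp
  have QE: "?Q \<subseteq> edges G" using p(3) by (auto simp: path_between_def)
  have eq: "U \<triangle> {x} \<triangle> ({x} \<triangle> {b}) = U \<triangle> {b}" "U \<triangle> {b} \<triangle> ({x} \<triangle> {b}) = U \<triangle> {x}" by auto
  have J1: "join G (U \<triangle> {b}) (J \<triangle> ?Q)" and K1: "join G (U \<triangle> {x}) (K \<triangle> ?Q)"
    using J' K' Q QE fin eq assms(1) bV by (simp_all add: bjoin_iff odd_verts_xor xor_subset)
  have "card (J \<triangle> ?Q) + card (K \<triangle> ?Q) = card J + card K" using card_xor_swap fin p(4) by blast
  then have "card (J \<triangle> ?Q) = lev G U b"
    using lev_le[OF J1] lev_le[OF K1] assms(4) K(2) by linarith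
  then have "(J \<triangle> ?Q) \<inter> cut G {b} = {}" using min_join_b J1 by blast
  then have "J \<inter> cut G {b} = ?Q \<inter> cut G {b}" by (auto simp: set_eq_iff)
  then show ?thesis using path_end_cut[OF graph(1) p(3)] p(2) y by simp
qed

lemma min_join_cut:
  assumes "x \<in> verts G" "join G (U \<triangle> {x}) J" "card J = lev G U x"
  shows "card (J \<inter> cut G {b}) = (if x = b then 0 else 1)"
  using assms min_join_card min_join_b by (auto simp del: card_0_eq)

definition N :: "'a set" where
  "N = {c. \<exists>e\<in>edges G. ends G e = {b, c}}"

lemma N_props:
  shows "N \<subseteq> verts G" "b \<notin> N" "finite N"
proof -
  show N: "N \<subseteq> verts G" using graph(1) by (auto simp: N_def finite_mgraph_def)
  then show "finite N" using finV finite_subset by auto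
  show "b \<notin> N" using graph(1) by (auto simp: N_def finite_mgraph_def)
qed

lemma lev_N: "c \<in> N \<Longrightarrow> lev G U c = Suc (lev G U b)"
proof -
  assume c: "c \<in> N"
  then obtain e where "e \<in> edges G" "ends G e = {b, c}" by (auto simp: N_def)
  then show ?thesis using lev_adjacent[OF rooted] lev_min[of c] c N_props(1) by fastforce
qed

text \<open>An exchange along a path joining two neighbours of \<open>b\<close> cannot make \<open>J\<close> smaller, because
  closing that path through \<open>b\<close> leaves a join with the wrong number of edges at \<open>b\<close>.\<close>

lemma exchange_bound:
  assumes x: "x \<in> verts G" and J: "join G (U \<triangle> {x}) J" "card J = lev G U x"
    and K: "K \<subseteq> edges G - cut G {b}" "odd_verts G (K \<triangle> (J - cut G {b})) \<subseteq> N"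
  shows "card (J - cut G {b}) \<le> card K"
  using K
\<comment> \<open>The measure is the number of vertices at which the boundaries of \<open>K\<close>
  and of \<open>J - cut G {b}\<close> differ; each exchange removes two of them.\<close>
proof (induction "card (odd_verts G (K \<triangle> (J - cut G {b})))" arbitrary: K rule: less_induct)
  case less
  let ?C = "cut G {b}"
  let ?A = "J - ?C"
  have JE: "J \<subseteq> edges G" "odd_verts G J = U \<triangle> {x}" using J(1) bjoin_iff[OF x] by auto
  have KE: "K \<subseteq> edges G" using less.prems(1) by auto
  have AE: "?A \<subseteq> edges G" using JE by auto
  have fin: "finite J" "finite K" "finite ?A" using JE KE finite_join[OF graph(1)] by auto
  let ?W = "odd_verts G (K \<triangle> ?A)"
  have fW: "finite ?W" using odd_verts_subset finV finite_subset by metis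
  have Jsplit: "card J = card ?A + card (J \<inter> ?C)"
    using card_Int_Diff[OF fin(1), of ?C] by simp
  show ?case
  proof (cases "?W = {}")
    case True
    \<comment> \<open>Equal boundaries: \<open>K\<close> together with the edges of \<open>J\<close>
      at \<open>b\<close> competes with \<open>J\<close>.\<close>
    let ?L = "K \<triangle> (J \<inter> ?C)"
    have "?L = (K \<triangle> ?A) \<triangle> J" using less.prems(1) by auto
    then have "odd_verts G ?L = U \<triangle> {x}" using True JE fin by (simp add: odd_verts_xor)
    moreover have "?L \<subseteq> edges G" using KE JE by auto
    ultimately have "join G (U \<triangle> {x}) ?L" using bjoin_iff[OF x] by simp
    then have "card J \<le> card ?L" using lev_le J(2) by metis
    moreover have "card ?L + 2 * card (K \<inter> (J \<inter> ?C)) = card K + card (J \<inter> ?C)"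
      using card_xor fin by blast
    ultimately show ?thesis using Jsplit by linarith
  next
    case False
    then obtain c1 where c1: "c1 \<in> ?W" by auto
    obtain c2 xs es where p: "c2 \<in> ?W" "c2 \<noteq> c1" "path_between G c1 xs es c2" "set es \<subseteq> K \<triangle> ?A"
      using path_in_join[OF graph(1) xor_subset[OF KE AE] c1] by metis
    let ?Q = "set es"
    have "K \<triangle> ?A \<subseteq> edges G - ?C" using less.prems(1) AE by (intro xor_subset) auto
    then have QC: "?Q \<inter> ?C = {}" using p(4) by blast
    have QE: "?Q \<subseteq> edges G" using p(3) by (auto simp: path_between_def)
    have Q: "odd_verts G ?Q = {c1} \<triangle> {c2}" using path_odd_verts[OF graph(1) p(3)] .
    have c12: "c1 \<in> N" "c2 \<in> N" using subsetD[OF less.prems(2)] c1 p(1) by blast+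
    then obtain e1 e2
      where e: "e1 \<in> edges G" "ends G e1 = {b, c1}" "e2 \<in> edges G" "ends G e2 = {b, c2}"
      unfolding N_def by auto
    have e12: "e1 \<noteq> e2" using e p(2) by (metis doubleton_eq_iff)
    have eC: "e1 \<in> ?C" "e2 \<in> ?C" using e in_cut_single_iff[OF graph(1)] by auto
    have cb: "c1 \<noteq> b" "c2 \<noteq> b" using c12 N_props(2) by auto
    \<comment> \<open>The path and the edges \<open>e1\<close>, \<open>e2\<close> form a closed walk
      through \<open>b\<close>, so toggling them keeps the boundary of \<open>J\<close>.\<close>
    let ?L = "J \<triangle> ?Q \<triangle> {e1} \<triangle> {e2}"
    have "odd_verts G ?L = odd_verts G J \<triangle> odd_verts G ?Q \<triangle> {b, c1} \<triangle> {b, c2}"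
      using fin e by (simp add: odd_verts_xor odd_verts_single[OF graph(1)])
    also have "\<dots> = U \<triangle> {x} \<triangle> (({c1} \<triangle> {c2}) \<triangle> {b, c1} \<triangle> {b, c2})"
      unfolding Q JE(2) by (simp add: xor_assoc)
    also have "({c1} \<triangle> {c2}) \<triangle> {b, c1} \<triangle> {b, c2} = {}" using cb p(2) by auto
    finally have "odd_verts G ?L = U \<triangle> {x}" by simp
    moreover have "?L \<subseteq> edges G" using JE QE e by (intro xor_subset) auto
    ultimately have L: "join G (U \<triangle> {x}) ?L" using bjoin_iff[OF x] by simp
    have "?L = (?A \<triangle> ?Q) \<union> ((J \<inter> ?C) \<triangle> {e1, e2})" using QC eC e12 by auto
    moreover have "(?A \<triangle> ?Q) \<inter> ((J \<inter> ?C) \<triangle> {e1, e2}) = {}" using QC eC by auto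
    ultimately have cardL: "card ?L = card (?A \<triangle> ?Q) + card ((J \<inter> ?C) \<triangle> {e1, e2})"
      using fin by (metis card_Un_disjoint finite.emptyI finite_Int finite_insert finite_set finite_xor)
    have cE: "card ((J \<inter> ?C) \<triangle> {e1, e2}) + 2 * card (J \<inter> ?C \<inter> {e1, e2}) = card (J \<inter> ?C) + 2"
      using card_xor[of "J \<inter> ?C" "{e1, e2}"] fin e12 by simp
    have "card ?A \<le> card (?A \<triangle> ?Q)"
    proof (cases "J \<inter> ?C \<inter> {e1, e2} = {}")
      \<comment> \<open>With two extra edges at \<open>b\<close>, \<open>?L\<close> is not minimum,
        since all minimum joins for \<open>x\<close> have the same number of edges there. By parity
        it is larger than \<open>J\<close> by at least two, which pays for \<open>e1\<close> and
        \<open>e2\<close>.\<close>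
      case True
      have LC: "?L \<inter> ?C = (J \<inter> ?C) \<triangle> {e1, e2}" using QC eC e12 by auto
      have "card (?L \<inter> ?C) = card (J \<inter> ?C) + 2" using LC cE True by simp
      then have "card ?L \<noteq> lev G U x"
        using min_join_cut[OF x L] min_join_cut[OF x J] by auto
      moreover have "odd (card ?L) = odd (card J)"
      proof -
        obtain A B where "colour_classes G A B" using rooted by (auto simp: rooted_def bipartite_def)
        moreover have "U \<triangle> {x} \<subseteq> verts G" using graph(2) x by auto
        ultimately show ?thesis using join_parity[OF graph(1)] L J(1) by metis
      qed
      ultimately have "card J + 2 \<le> card ?L"
        using lev_le[OF L] J(2) by presburger
      then show ?thesis using cardL cE True Jsplit by simp
    next
      \<comment> \<open>Here toggling \<open>e1\<close> and \<open>e2\<close> does not raise the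
        number of edges at \<open>b\<close>, so minimality of \<open>J\<close> alone gives the
        bound.\<close>
      case False
      then have "1 \<le> card (J \<inter> ?C \<inter> {e1, e2})" using fin
        by (metis One_nat_def Suc_leI card_gt_0_iff finite_Int)
      then show ?thesis using cardL cE Jsplit lev_le[OF L] J(2) by linarith
    qed
    moreover have "card (K \<triangle> ?Q) + card (?A \<triangle> ?Q) = card K + card ?A"
      using card_xor_swap fin p(4) by blast
    moreover have "card ?A \<le> card (K \<triangle> ?Q)"
    proof (rule less.hyps)
      have "K \<triangle> ?Q \<triangle> ?A = K \<triangle> ?A \<triangle> ?Q" by auto
      then have W: "odd_verts G (K \<triangle> ?Q \<triangle> ?A) = ?W \<triangle> ({c1} \<triangle> {c2})"
        using fin Q by (simp add: odd_verts_xor)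
      have sub: "?W \<triangle> ({c1} \<triangle> {c2}) \<subset> ?W" using c1 p(1,2) by auto
      show "card (odd_verts G (K \<triangle> ?Q \<triangle> ?A)) < card ?W"
        unfolding W using sub fW by (rule psubset_card_mono[rotated])
      show "odd_verts G (K \<triangle> ?Q \<triangle> ?A) \<subseteq> N" unfolding W using sub less.prems(2) by blast
      show "K \<triangle> ?Q \<subseteq> edges G - ?C" using less.prems(1) QE QC by auto
    qed
    ultimately show ?thesis by linarith
  qed
qed

end

section \<open>Contracting the star of a vertex of lowest level\<close>

lemma colour_classes_swap: "colour_classes G A B \<Longrightarrow> colour_classes G B A"
  unfolding colour_classes_def by (metis Un_commute Int_commute insert_commute)

lemma colour_classesI:
  assumes "A \<union> B = verts G" "A \<inter> B = {}"
    "\<And>e. e \<in> edges G \<Longrightarrow> \<exists>a\<in>A. \<exists>b\<in>B. ends G e = {a, b}"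
  shows "colour_classes G A B"
  using assms by (simp add: colour_classes_def)

lemma colour_edge:
  assumes "colour_classes G A B" "e \<in> edges G" "ends G e = {u, v}"
  shows "u \<in> A \<and> v \<in> B \<or> v \<in> A \<and> u \<in> B"
proof -
  obtain a b where "a \<in> A" "b \<in> B" "{u, v} = {a, b}"
    using assms unfolding colour_classes_def by metis
  then show ?thesis by (auto simp: doubleton_eq_iff)
qed

context level_min
begin

definition con :: "'a \<Rightarrow> 'a" where
  "con x = (if x \<in> N then b else x)"

text \<open>The merged vertex keeps the name \<open>b\<close>, so the induction needs no new vertex.
  Only the edges at \<open>b\<close> are deleted, because no other edge has both ends in the merged
  set (\<open>star_con_edge\<close>).\<close>

definition star_con :: "('a, 'e) mgraph" where
  "star_con = \<lparr>verts = verts G - N, edges = edges G - cut G {b}, ends = (\<lambda>e. con ` ends G e)\<rparr>"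

definition proj :: "'a set \<Rightarrow> 'a set" where
  "proj W = (W - insert b N) \<union> (if odd (card (W \<inter> insert b N)) then {b} else {})"

lemma star_con_simps [simp]:
  "verts star_con = verts G - N" "edges star_con = edges G - cut G {b}"
  "ends star_con e = con ` ends G e"
  by (simp_all add: star_con_def)

lemma con_b [simp]: "con b = b"
  using N_props by (simp add: con_def)

text \<open>All neighbours of \<open>b\<close> lie on one level and adjacent vertices never do, so
  at most one end is merged. The end outside \<open>N\<close> is listed second, which makes the
  description of the contracted edge uniform.\<close>

lemma star_con_edge:
  assumes "e \<in> edges G - cut G {b}"
  obtains u v where "ends G e = {u, v}" "u \<noteq> b" "v \<noteq> b" "v \<notin> N" "u \<noteq> v"
    "u \<in> verts G" "v \<in> verts G" "ends star_con e = {con u, v}" "con u \<noteq> v"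
proof -
  have e: "e \<in> edges G" using assms by auto
  then obtain u v where uv: "ends G e = {u, v}" "u \<noteq> v" "u \<in> verts G" "v \<in> verts G"
    using ends_doubleton[OF graph(1)] by metis
  have nb: "u \<noteq> b" "v \<noteq> b" using assms in_cut_single_iff[OF graph(1) e, of b] uv by auto
  have "u \<notin> N \<or> v \<notin> N"
    using lev_adjacent[OF rooted e uv(1)] lev_N by fastforce
  then show thesis
  proof
    assume "v \<notin> N"
    then have "con v = v" "con u \<noteq> v" using uv nb by (auto simp: con_def)
    moreover from this have "ends star_con e = {con u, v}" using uv by simp
    ultimately show thesis using that[of u v] uv nb \<open>v \<notin> N\<close> by metis
  next
    assume "u \<notin> N"
    then have "con u = u" "con v \<noteq> u" using uv nb by (auto simp: con_def)
    moreover from this have "ends star_con e = {con v, u}" using uv by (simp add: insert_commute)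
    ultimately show thesis using that[of v u] uv nb \<open>u \<notin> N\<close> by (metis insert_commute)
  qed
qed

text \<open>Only the merged vertex needs an argument: the edges of \<open>J\<close> now incident
  with it are those leaving \<open>insert b N\<close>, and \<open>cut_parity\<close> counts
  them.\<close>

lemma odd_verts_star_con:
  assumes "J \<subseteq> edges G - cut G {b}"
  shows "odd_verts star_con J = proj (odd_verts G J)"
proof -
  let ?S = "insert b N"
  have JE: "J \<subseteq> edges G" using assms by auto
  have "{e \<in> J. v \<in> con ` ends G e} = {e \<in> J. v \<in> ends G e}" if "v \<noteq> b" "v \<notin> N" for v
    using that by (auto simp: con_def split: if_splits)
  moreover have "{e \<in> J. b \<in> con ` ends G e} = J \<inter> cut G ?S"
  proof -
    have "b \<in> con ` ends G e \<longleftrightarrow> e \<in> cut G ?S" if e: "e \<in> J" for e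
    proof -
      obtain u v where *: "ends G e = {u, v}" "u \<noteq> b" "v \<noteq> b" "v \<notin> N"
        using star_con_edge subsetD[OF assms e] by metis
      then show ?thesis using in_cut_iff[OF graph(1) _ *(1)] JE e by (auto simp: con_def)
    qed
    then show ?thesis by auto
  qed
  moreover have "odd (card (J \<inter> cut G ?S)) \<longleftrightarrow> odd (card (odd_verts G J \<inter> ?S))"
    by (rule cut_parity[OF graph(1) JE]) (simp add: N_props)
  ultimately have mem: "odd (card {e \<in> J. v \<in> ends star_con e}) \<longleftrightarrow>
      (if v = b then odd (card (odd_verts G J \<inter> ?S)) else odd (card {e \<in> J. v \<in> ends G e}))"
    if "v \<notin> N" for v
    using that by simp
  show ?thesis
  proof (rule set_eqI)
    fix v
    consider "v \<in> N" | "v = b" | "v \<notin> ?S" by blast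
    then show "v \<in> odd_verts star_con J \<longleftrightarrow> v \<in> proj (odd_verts G J)"
    proof cases
      case 1
      then show ?thesis using N_props(2) by (auto simp: odd_verts_def proj_def)
    next
      case 2
      then show ?thesis using mem[of b] bV N_props(2) by (simp add: odd_verts_def[of star_con] proj_def)
    next
      case 3
      then show ?thesis using mem[of v] by (simp add: odd_verts_def proj_def)
    qed
  qed
qed

lemma proj_xor:
  assumes "W \<subseteq> verts G" "X \<subseteq> verts G"
  shows "proj (W \<triangle> X) = proj W \<triangle> proj X"
proof -
  let ?S = "insert b N"
  have "finite (W \<inter> ?S)" "finite (X \<inter> ?S)" using N_props(3) by auto
  then have "odd (card ((W \<triangle> X) \<inter> ?S)) \<longleftrightarrow> odd (card (W \<inter> ?S)) \<noteq> odd (card (X \<inter> ?S))"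
    unfolding xor_Int by (rule odd_card_xor)
  then show ?thesis by (auto simp: proj_def)
qed

lemma proj_single: "proj {x} = {con x}"
proof -
  have "{x} \<inter> insert b N = (if x \<in> insert b N then {x} else {})" by auto
  then show ?thesis by (auto simp: proj_def con_def)
qed

lemma proj_subset: "W \<subseteq> verts G \<Longrightarrow> proj W \<subseteq> verts star_con"
  using bV N_props by (auto simp: proj_def)

lemma proj_odd_card:
  assumes "W \<subseteq> verts G"
  shows "odd (card (proj W)) \<longleftrightarrow> odd (card W)"
proof -
  let ?S = "insert b N"
  have f: "finite W" using assms finV finite_subset by auto
  have "card W = card (W - ?S) + card (W \<inter> ?S)" using card_Int_Diff[OF f, of ?S] by simp
  moreover have "card (proj W) = card (W - ?S) + (if odd (card (W \<inter> ?S)) then 1 else 0)"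
    using f by (simp add: proj_def)
  ultimately show ?thesis by simp
qed

lemma con_in: "x \<in> verts G \<Longrightarrow> con x \<in> verts G - N"
  using bV N_props by (auto simp: con_def)

text \<open>The ends of these edges all lie in the merged set, and a boundary has even size.
  Deleting edges at \<open>b\<close> is thus invisible after contraction.\<close>

lemma proj_cut: "C \<subseteq> cut G {b} \<Longrightarrow> proj (odd_verts G C) = {}"
proof -
  assume C: "C \<subseteq> cut G {b}"
  have CE: "C \<subseteq> edges G" using C cut_subset by fast
  have "odd_verts G C \<subseteq> insert b N"
  proof
    fix v assume v: "v \<in> odd_verts G C"
    then have "odd (card {e \<in> C. v \<in> ends G e})" by (simp add: odd_verts_def)
    then have "{e \<in> C. v \<in> ends G e} \<noteq> {}" by (metis card.empty even_zero)
    then obtain e where e: "e \<in> C" "v \<in> ends G e" by auto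
    then obtain c where "ends G e = {b, c}" "e \<in> edges G" using C cut_bE[of e] by blast
    then show "v \<in> insert b N" using e unfolding N_def by blast
  qed
  moreover have "even (card (odd_verts G C))"
  proof -
    have "cut G (verts G) = {}"
      using graph(1) by (auto simp: cut_def finite_mgraph_def Int_absorb2)
    then have "even (card (odd_verts G C \<inter> verts G))"
      using cut_parity[OF graph(1) CE finV] by simp
    then show ?thesis using odd_verts_subset[of G C] by (simp add: Int_absorb2)
  qed
  ultimately show ?thesis by (auto simp: proj_def Int_absorb2)
qed

lemma join_star_con:
  assumes "W \<subseteq> verts G" "join G (U \<triangle> W) J"
  shows "join star_con (proj U \<triangle> proj W) (J - cut G {b})"
proof -
  let ?C = "J \<inter> cut G {b}"
  have UW: "U \<triangle> W \<subseteq> verts G" using assms(1) graph(2) by (intro xor_subset)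
  then have J: "J \<subseteq> edges G" "odd_verts G J = U \<triangle> W" using assms(2) by (auto simp: join_iff)
  have fin: "finite J" "finite ?C" using J(1) finite_join[OF graph(1)] by auto
  have "J - cut G {b} = J \<triangle> ?C" by auto
  then have "odd_verts G (J - cut G {b}) = U \<triangle> W \<triangle> odd_verts G ?C"
    using fin J by (simp add: odd_verts_xor)
  moreover have "J - cut G {b} \<subseteq> edges G - cut G {b}" using J(1) by auto
  ultimately have "odd_verts star_con (J - cut G {b}) = proj U \<triangle> proj W"
    using odd_verts_star_con[of "J - cut G {b}"] proj_xor[OF UW odd_verts_subset, of ?C]
      proj_cut[of ?C] proj_xor[OF graph(2) assms(1)] by simp
  moreover have "proj U \<triangle> proj W \<subseteq> verts star_con"
    using proj_subset[OF graph(2)] proj_subset[OF assms(1)] by (intro xor_subset)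
  ultimately show ?thesis using J(1) by (auto simp: join_iff)
qed

lemma join_star_con_single:
  assumes "x \<in> verts G" "join G (U \<triangle> {x}) J"
  shows "join star_con (proj U \<triangle> {con x}) (J - cut G {b})"
  using join_star_con[of "{x}" J] assms by (simp add: proj_single)

lemma card_split_b:
  assumes "x \<in> verts G" "join G (U \<triangle> {x}) J" "card J = lev G U x"
  shows "lev G U x = card (J - cut G {b}) + (if x = b then 0 else 1)"
proof -
  have "finite J" using assms finite_join[OF graph(1)] by (auto simp: join_def)
  then show ?thesis using card_Int_Diff[of J "cut G {b}"] min_join_cut[OF assms] assms(3) by simp
qed

lemma finite_mgraph_star_con: "finite_mgraph star_con"
proof -
  have "con ` ends G e \<subseteq> verts G - N \<and> card (con ` ends G e) = 2" if e: "e \<in> edges G - cut G {b}" for e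
  proof -
    obtain u v where "v \<notin> N" "u \<in> verts G" "v \<in> verts G" "ends star_con e = {con u, v}" "con u \<noteq> v"
      using star_con_edge[OF e] by metis
    then show ?thesis using con_in[of u] by auto
  qed
  then show ?thesis using graph(1) by (auto simp: finite_mgraph_def)
qed

text \<open>The merged vertex changes sides: its remaining edges come from neighbours of
  \<open>b\<close>, so it belongs to their colour class and not to the old class of
  \<open>b\<close>.\<close>

lemma bipartite_star_con: "bipartite star_con"
proof -
  obtain A B where AB: "colour_classes G A B" "b \<in> A"
  proof -
    obtain A B where *: "colour_classes G A B" using rooted by (auto simp: rooted_def bipartite_def)
    moreover have "b \<in> A \<or> b \<in> B" using * bV by (auto simp: colour_classes_def)
    ultimately show thesis using that colour_classes_swap by blast
  qed
  have dis: "A \<inter> B = {}" "A \<union> B = verts G" using AB by (auto simp: colour_classes_def)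
  have other: "v \<in> B" if "e \<in> edges G" "ends G e = {u, v}" "u \<in> A" for e u v
    using colour_edge[OF AB(1) that(1,2)] that(3) dis by auto
  have other': "u \<in> A" if "e \<in> edges G" "ends G e = {u, v}" "v \<in> B" for e u v
    using colour_edge[OF AB(1) that(1,2)] that(3) dis by auto
  have NB: "N \<subseteq> B" using other AB(2) unfolding N_def by auto
  have edge: "\<exists>a\<in>A - {b}. \<exists>c\<in>insert b (B - N). ends star_con e = {a, c}" if e: "e \<in> edges star_con" for e
  proof -
    have e': "e \<in> edges G - cut G {b}" using e by simp
    obtain u v where *: "ends G e = {u, v}" "u \<noteq> b" "v \<noteq> b" "v \<notin> N" "u \<noteq> v" "u \<in> verts G" "v \<in> verts G"
      "ends star_con e = {con u, v}" "con u \<noteq> v"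
      using star_con_edge[OF e'] by metis
    show ?thesis
    proof (cases "u \<in> A")
      case True
      then have "v \<in> B" "u \<notin> N" using other e' *(1) NB dis by auto
      then have "con u = u" "u \<in> A - {b}" "v \<in> insert b (B - N)" using True *(2,4) by (simp_all add: con_def)
      then show ?thesis using *(8) by metis
    next
      case False
      then have "u \<in> B" using * dis by auto
      then have "v \<in> A" using other'[of e v u] e' *(1) by (auto simp: insert_commute)
      then have "v \<in> A - {b}" "con u \<in> insert b (B - N)" using \<open>u \<in> B\<close> *(3) by (simp_all add: con_def)
      then show ?thesis using *(8) by (metis insert_commute)
    qed
  qed
  have un: "A - {b} \<union> insert b (B - N) = verts star_con"
    unfolding star_con_simps dis(2)[symmetric] using dis(1) NB AB(2) by blast
  have int: "(A - {b}) \<inter> insert b (B - N) = {}" using dis(1) by blast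
  show ?thesis unfolding bipartite_def
    by (rule exI, rule exI, rule colour_classesI[OF un int edge])
qed

lemma rooted_star_con: "rooted star_con (proj U)"
proof -
  have "\<exists>J. join star_con (proj U \<triangle> {x}) J" if "x \<in> verts star_con" for x
  proof -
    have x: "x \<in> verts G" "con x = x" using that by (auto simp: con_def)
    then obtain J where "join G (U \<triangle> {x}) J" using rooted by (auto simp: rooted_def)
    then show ?thesis using join_star_con_single x by metis
  qed
  then show ?thesis
    using finite_mgraph_star_con bipartite_star_con proj_subset[OF graph(2)] by (auto simp: rooted_def)
qed

text \<open>Deleting the edges at \<open>b\<close> from a minimum join gives one inequality. For the
  other, a minimum join \<open>K\<close> of the contraction has the right boundary up to vertices of
  \<open>N\<close>, which is all that \<open>exchange_bound\<close> asks for. The summand 1 is the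
  single deleted edge at \<open>b\<close>.\<close>

lemma lev_star_con:
  assumes "x \<in> verts G"
  shows "lev G U x = lev star_con (proj U) (con x) + (if x = b then 0 else 1)"
proof -
  obtain J where J: "join G (U \<triangle> {x}) J" "card J = lev G U x"
    using lev_attained[OF rooted assms] by metis
  have le: "lev star_con (proj U) (con x) \<le> card (J - cut G {b})"
    using lev_le[OF join_star_con_single[OF assms J(1)]] .
  obtain K where K: "join star_con (proj U \<triangle> {con x}) K" "card K = lev star_con (proj U) (con x)"
    using lev_attained[OF rooted_star_con, of "con x"] con_in[OF assms] by auto
  have K': "K \<subseteq> edges G - cut G {b}" "odd_verts star_con K = proj U \<triangle> {con x}"
    using K(1) rooted_join_iff[OF rooted_star_con, of "con x" K] con_in[OF assms] by auto
  let ?A = "J - cut G {b}"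
  have JE: "J \<subseteq> edges G" using J(1) by (auto simp: join_def)
  have A': "odd_verts star_con ?A = proj U \<triangle> {con x}"
    using join_star_con_single[OF assms J(1)] rooted_join_iff[OF rooted_star_con, of "con x" ?A] con_in[OF assms]
    by auto
  have fin: "finite K" "finite ?A" using K'(1) JE finite_join[OF graph(1)] by auto
  have sub: "K \<triangle> ?A \<subseteq> edges G - cut G {b}" using K'(1) JE by (intro xor_subset) auto
  have "odd_verts star_con (K \<triangle> ?A) = {}" using K'(2) A' fin by (simp add: odd_verts_xor)
  then have pe: "proj (odd_verts G (K \<triangle> ?A)) = {}" using odd_verts_star_con[OF sub] by simp
  have "b \<notin> odd_verts G (K \<triangle> ?A)"
  proof -
    have "{e \<in> K \<triangle> ?A. b \<in> ends G e} = {}"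
      using sub in_cut_single_iff[OF graph(1), of _ b] by blast
    then have "card {e \<in> K \<triangle> ?A. b \<in> ends G e} = 0" by (simp only: card.empty)
    then show ?thesis unfolding odd_verts_def by (simp only: mem_Collect_eq even_zero not_True_eq_False simp_thms)
  qed
  then have "odd_verts G (K \<triangle> ?A) \<subseteq> N" using pe by (auto simp: proj_def split: if_splits)
  then have "card ?A \<le> card K" by (rule exchange_bound[OF assms J K'(1)])
  then show ?thesis using card_split_b[OF assms J] le K(2) by auto
qed

lemma min_join_star_con:
  assumes "x \<in> verts G" "join G (U \<triangle> {x}) J" "card J = lev G U x"
  shows "card (J - cut G {b}) = lev star_con (proj U) (con x)"
  using card_split_b[OF assms] lev_star_con[OF assms(1)] by simp

lemma N_nonempty:
  assumes "x \<in> verts G" "x \<noteq> b"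
  shows "N \<noteq> {}"
proof -
  obtain J where "join G (U \<triangle> {x}) J" "card J = lev G U x"
    using lev_attained[OF rooted assms(1)] by metis
  then have "card (J \<inter> cut G {b}) = 1" using min_join_card assms by blast
  then have "cut G {b} \<noteq> {}" by auto
  then show ?thesis using cut_bE unfolding N_def by blast
qed

lemma card_verts_star_con:
  assumes "x \<in> verts G" "x \<noteq> b"
  shows "card (verts star_con) < card (verts G)"
  using N_nonempty[OF assms] N_props finV by (auto intro!: psubset_card_mono)

end

section \<open>Level components\<close>

text \<open>A connected component of the subgraph below level \<open>k\<close>. Connectedness is
  expressed by cuts and not by paths, because in this form it passes to a contraction by taking the
  preimage of a subset.\<close>

definition level_comp :: "('a, 'e) mgraph \<Rightarrow> 'a set \<Rightarrow> nat \<Rightarrow> 'a set \<Rightarrow> bool" where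
  "level_comp G U k D \<longleftrightarrow> D \<noteq> {} \<and> D \<subseteq> verts G \<and> (\<forall>v\<in>D. lev G U v < k) \<and>
     (\<forall>e\<in>edges G. \<forall>u v. ends G e = {u, v} \<longrightarrow> u \<in> D \<longrightarrow> v \<notin> D \<longrightarrow> k \<le> lev G U v) \<and>
     (\<forall>X. X \<subset> D \<longrightarrow> X \<noteq> {} \<longrightarrow> (\<exists>e\<in>cut G X. ends G e \<subseteq> D))"

lemma level_compD:
  assumes "level_comp G U k D"
  shows "D \<noteq> {}" "D \<subseteq> verts G" "v \<in> D \<Longrightarrow> lev G U v < k"
    "\<lbrakk>e \<in> edges G; ends G e = {u, v}; u \<in> D; v \<notin> D\<rbrakk> \<Longrightarrow> k \<le> lev G U v"
    "\<lbrakk>X \<subset> D; X \<noteq> {}\<rbrakk> \<Longrightarrow> \<exists>e\<in>cut G X. ends G e \<subseteq> D"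
  using assms unfolding level_comp_def by blast+

lemma level_min_exists:
  assumes "rooted G U" "x \<in> verts G"
  obtains b where "level_min G U b"
proof -
  obtain b where "b \<in> verts G" "\<forall>y. y \<in> verts G \<longrightarrow> lev G U b \<le> lev G U y"
    using ex_has_least_nat[of "\<lambda>v. v \<in> verts G" x "lev G U"] assms(2) by auto
  then show thesis using that assms(1) by (simp add: level_min_def)
qed

context level_min
begin

text \<open>If \<open>b\<close> is in \<open>D\<close>, connectedness provides an edge at
  \<open>b\<close> inside \<open>D\<close>, so the common level of all neighbours is below
  \<open>k\<close> and they all belong to \<open>D\<close>. If a neighbour is in \<open>D\<close>,
  then \<open>b\<close> has a lower level and cannot be outside. Thus merging the star never cuts
  through such a component.\<close>

lemma level_comp_star:
  assumes "level_comp G U k D" "D \<noteq> {b}"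
  shows "c \<in> N \<Longrightarrow> c \<in> D \<longleftrightarrow> b \<in> D" "b \<in> D \<Longrightarrow> Suc (lev G U b) < k"
proof -
  note D = level_compD[OF assms(1)]
  show lt: "Suc (lev G U b) < k" if b: "b \<in> D"
  proof -
    have "{b} \<subset> D" using b assms(2) by auto
    then obtain e where e: "e \<in> cut G {b}" "ends G e \<subseteq> D" using D(5) by blast
    obtain c where c: "ends G e = {b, c}" "e \<in> edges G" using cut_bE[OF e(1)] by metis
    then have "c \<in> N" "c \<in> D" using e(2) by (auto simp: N_def)
    then show ?thesis using D(3) lev_N by force
  qed
  assume c: "c \<in> N"
  then obtain e where e: "e \<in> edges G" "ends G e = {b, c}" "ends G e = {c, b}"
    unfolding N_def by (auto simp: insert_commute)
  show "c \<in> D \<longleftrightarrow> b \<in> D"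
  proof
    assume "c \<in> D"
    then show "b \<in> D" using D(4)[OF e(1,3)] D(3)[of c] lev_N[OF c] by linarith
  next
    assume "b \<in> D"
    then show "c \<in> D" using D(4)[OF e(1,2)] lt lev_N[OF c] by linarith
  qed
qed

lemma con_image_iff:
  assumes "level_comp G U k D" "D \<noteq> {b}" "v \<in> verts G"
  shows "con v \<in> con ` D \<longleftrightarrow> v \<in> D"
proof
  assume "con v \<in> con ` D"
  then obtain w where "w \<in> D" "con v = con w" by auto
  then show "v \<in> D" using level_comp_star(1)[OF assms(1,2)] by (auto simp: con_def split: if_splits)
qed auto

text \<open>The merged set lies entirely inside or entirely outside \<open>D\<close>, so merging
  changes no crossing edge and no deleted edge crosses.\<close>

lemma level_comp_cut:
  assumes "level_comp G U k D" "D \<noteq> {b}"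
  shows "cut star_con (con ` D) = cut G D"
proof -
  have iff: "e \<in> cut star_con (con ` D) \<longleftrightarrow> e \<in> cut G D" if e: "e \<in> edges G - cut G {b}" for e
  proof -
    obtain u v where *: "ends G e = {u, v}" "u \<in> verts G" "v \<in> verts G" "v \<notin> N"
      "ends star_con e = {con u, v}"
      using star_con_edge[OF e] by metis
    have "con v = v" using *(4) by (simp add: con_def)
    have "e \<in> cut star_con (con ` D) \<longleftrightarrow> (con u \<in> con ` D) \<noteq> (v \<in> con ` D)"
      using e by (intro in_cut_iff finite_mgraph_star_con *(5)) simp
    also have "\<dots> \<longleftrightarrow> (u \<in> D) \<noteq> (v \<in> D)"
      using con_image_iff[OF assms *(2)] con_image_iff[OF assms *(3)] \<open>con v = v\<close> by simp
    also have "\<dots> \<longleftrightarrow> e \<in> cut G D" using in_cut_iff[OF graph(1) _ *(1)] e by simp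
    finally show ?thesis .
  qed
  have "cut G D \<inter> cut G {b} = {}"
  proof (rule ccontr)
    assume "cut G D \<inter> cut G {b} \<noteq> {}"
    then obtain e where e: "e \<in> cut G D" "e \<in> cut G {b}" by auto
    obtain c where c: "ends G e = {b, c}" "e \<in> edges G" using cut_bE[OF e(2)] by metis
    then have "c \<in> N" by (auto simp: N_def)
    then show False using level_comp_star(1)[OF assms] in_cut_iff[OF graph(1) c(2,1)] e(1) by auto
  qed
  moreover have "cut star_con (con ` D) \<subseteq> edges G - cut G {b}"
    using cut_subset[of star_con] by simp
  moreover have "cut G D \<subseteq> edges G" by (rule cut_subset)
  ultimately show ?thesis using iff by blast
qed

text \<open>All levels but that of \<open>b\<close> fall by one, hence the threshold
  \<open>k - 1\<close>. The level of \<open>b\<close> stays, but \<open>level_comp_star\<close>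
  leaves it room below the new threshold.\<close>

lemma level_comp_star_con:
  assumes "level_comp G U k D" "D \<noteq> {b}"
  shows "level_comp star_con (proj U) (k - 1) (con ` D)"
proof -
  note D = level_compD[OF assms(1)]
  have lev: "lev star_con (proj U) (con v) = lev G U v - (if v = b then 0 else 1)" if "v \<in> verts G" for v
    using lev_star_con[OF that] by simp
  \<comment> \<open>Levels are natural numbers; positivity makes the truncated subtraction
    exact.\<close>
  have pos: "0 < lev G U v" if "v \<in> verts G" "v \<noteq> b" for v
    using lev_star_con[OF that(1)] that(2) by simp
  have "lev star_con (proj U) v < k - 1" if v: "v \<in> con ` D" for v
  proof -
    obtain w where w: "v = con w" "w \<in> D" "w \<in> verts G" using v D(2) by auto
    then show ?thesis
      using lev[of w] D(3)[of w] level_comp_star(2)[OF assms] pos[of w] by (cases "w = b") auto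
  qed
  moreover have "k - 1 \<le> lev star_con (proj U) v'"
    if e: "e \<in> edges star_con" "ends star_con e = {u', v'}" "u' \<in> con ` D" "v' \<notin> con ` D" for e u' v'
  proof -
    have e': "e \<in> edges G - cut G {b}" using e by simp
    obtain u v where *: "ends G e = {u, v}" "u \<in> verts G" "v \<in> verts G" "v \<notin> N" "u \<noteq> b" "v \<noteq> b"
      "ends star_con e = {con u, v}"
      using star_con_edge[OF e'] by metis
    have cv: "con v = v" using *(4) by (simp add: con_def)
    have *: "ends G e = {u, v}" "ends G e = {v, u}" "u \<in> verts G" "v \<in> verts G" "u \<noteq> b" "v \<noteq> b"
      "{u', v'} = {con u, con v}" using * cv e(2) by auto
    have eG: "e \<in> edges G" using e' by simp
    consider "u' = con u" "v' = con v" | "u' = con v" "v' = con u"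
      using *(7) by (auto simp: doubleton_eq_iff)
    then show ?thesis
    proof cases
      case 1
      then have "u \<in> D" "v \<notin> D" using e(3,4) con_image_iff[OF assms] *(3,4) by auto
      then show ?thesis using D(4)[OF eG *(1)] lev[OF *(4)] *(6) 1 by simp
    next
      case 2
      then have "v \<in> D" "u \<notin> D" using e(3,4) con_image_iff[OF assms] *(3,4) by auto
      then show ?thesis using D(4)[OF eG *(2)] lev[OF *(3)] *(5) 2 by simp
    qed
  qed
  moreover have "\<exists>e\<in>cut star_con X'. ends star_con e \<subseteq> con ` D"
    if X': "X' \<subset> con ` D" "X' \<noteq> {}" for X'
  proof -
    let ?X = "{v \<in> D. con v \<in> X'}"
    have "?X \<subset> D" "?X \<noteq> {}" using X' by auto
    then obtain e where e: "e \<in> cut G ?X" "ends G e \<subseteq> D" using D(5) by blast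
    have eE: "e \<in> edges G" using e(1) cut_subset by fast
    obtain u v where uv: "ends G e = {u, v}" using ends_doubleton[OF graph(1) eE] by metis
    have "u \<in> D" "v \<in> D" using e(2) uv by auto
    then have ne: "(con u \<in> X') \<noteq> (con v \<in> X')" using in_cut_iff[OF graph(1) eE uv] e(1) by simp
    \<comment> \<open>An edge at \<open>b\<close> would have both ends merged into \<open>b\<close>,
      so it could not cross the preimage of \<open>X'\<close>.\<close>
    have "e \<notin> cut G {b}"
    proof
      assume "e \<in> cut G {b}"
      then obtain c where c: "ends G e = {b, c}" using cut_bE by metis
      then have "c \<in> N" using eE by (auto simp: N_def)
      then have "con c = b" by (simp add: con_def)
      moreover have "u = b \<and> v = c \<or> u = c \<and> v = b" using uv c by (metis doubleton_eq_iff)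
      ultimately have "con u = b" "con v = b" by auto
      then show False using ne by simp
    qed
    then have eS: "e \<in> edges star_con" using eE by simp
    have ends: "ends star_con e = {con u, con v}" using uv by simp
    have "e \<in> cut star_con X'"
      using in_cut_iff[OF finite_mgraph_star_con eS ends] ne by simp
    moreover have "ends star_con e \<subseteq> con ` D" unfolding ends using \<open>u \<in> D\<close> \<open>v \<in> D\<close> by simp
    ultimately show ?thesis by metis
  qed
  moreover have "con ` D \<noteq> {}" using D(1) by simp
  moreover have "con ` D \<subseteq> verts star_con" using D(2) con_in by auto
  ultimately show ?thesis unfolding level_comp_def by (intro conjI ballI allI impI) simp_all
qed

end

text \<open>Contracting the star of \<open>b\<close> preserves everything in the statement: the
  component, its boundary and the minimality of the join. The only component it could destroy is
  \<open>{b}\<close>, and there the claim is the count of edges at \<open>b\<close>.\<close>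

theorem level_comp_crossing:
  assumes "rooted G U" "level_comp G U k D" "x \<in> verts G"
    "join G (U \<triangle> {x}) J" "card J = lev G U x"
  shows "card (J \<inter> cut G D) = (if x \<in> D then 0 else 1)"
  using assms
proof (induction "card (verts G)" arbitrary: G U k D x J rule: less_induct)
  case less
  obtain b where "level_min G U b" using level_min_exists[OF less.prems(1,3)] by metis
  then interpret level_min G U b .
  show ?case
  proof (cases "D = {b}")
    case True
    then show ?thesis using min_join_cut[OF less.prems(3-5)] by simp
  next
    case False
    note D = less.prems(2) False
    obtain y where "y \<in> verts G" "y \<noteq> b" using level_compD(1,2)[OF D(1)] False by blast
    then have smaller: "card (verts star_con) < card (verts G)" by (rule card_verts_star_con)
    have "card ((J - cut G {b}) \<inter> cut star_con (con ` D)) = (if con x \<in> con ` D then 0 else 1)"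
      using less.hyps[OF smaller rooted_star_con level_comp_star_con[OF D] _
          join_star_con_single[OF less.prems(3,4)] min_join_star_con[OF less.prems(3-5)]]
        con_in[OF less.prems(3)] by simp
    moreover have "(J - cut G {b}) \<inter> cut star_con (con ` D) = J \<inter> cut G D"
      using level_comp_cut[OF D] cut_subset[of star_con "con ` D"] by auto
    ultimately show ?thesis using con_image_iff[OF D less.prems(3)] by simp
  qed
qed

text \<open>Each contraction lowers the top level by one and removes at least one edge of
  \<open>J\<close>: since \<open>b\<close> lies below the top, it is in \<open>U\<close> but not in
  \<open>W\<close>, which makes \<open>J\<close> odd at \<open>b\<close>. Oddness of
  \<open>W\<close> survives the merging, so \<open>W\<close> never becomes empty.\<close>

theorem top_level_join_bound:
  assumes "rooted G U" "\<And>v. v \<in> verts G \<Longrightarrow> lev G U v \<le> M"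
    "W \<subseteq> verts G" "\<And>v. v \<in> W \<Longrightarrow> lev G U v = M" "odd (card W)" "join G (U \<triangle> W) J"
  shows "M \<le> card J"
  using assms
proof (induction "card (verts G)" arbitrary: G U M W J rule: less_induct)
  case less
  obtain w where w: "w \<in> W" using less.prems(5) by (metis all_not_in_conv card.empty even_zero)
  have wV: "w \<in> verts G" using w less.prems(3) by auto
  obtain b where "level_min G U b" using level_min_exists[OF less.prems(1) wV] by metis
  then interpret level_min G U b .
  have JE: "J \<subseteq> edges G" using less.prems(6) by (auto simp: join_def)
  show ?case
  proof (cases "verts G = {b}")
    case True
    have "edges G = {}" using ends_doubleton[OF graph(1)] True by (metis all_not_in_conv singletonD)
    then have "lev G U b = 0"
      using lev_attained[OF rooted bV] by (metis bjoin_iff bV card.empty subset_empty)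
    then show ?thesis using less.prems(4)[OF w] wV True by simp
  next
    case False
    then obtain y where y: "y \<in> verts G" "y \<noteq> b" using bV by blast
    have smaller: "card (verts star_con) < card (verts G)" by (rule card_verts_star_con[OF y])
    obtain c where c: "c \<in> N" using N_nonempty[OF y] by auto
    have bM: "Suc (lev G U b) \<le> M" using lev_N[OF c] less.prems(2)[of c] c N_props(1) by auto
    have bW: "b \<notin> W" using less.prems(4)[of b] bM by auto
    have sub: "U \<triangle> W \<subseteq> verts G" using graph(2) less.prems(3) by (rule xor_subset)
    have "odd_verts G J = U \<triangle> W" using less.prems(6) by (simp add: join_iff[OF sub])
    moreover have "(U \<triangle> W) \<inter> {b} = {b}" using b_in_U bW by auto
    ultimately have "odd (card (J \<inter> cut G {b}))" using cut_parity[OF graph(1) JE, of "{b}"] by simp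
    then have "1 \<le> card (J \<inter> cut G {b})" by (metis One_nat_def Suc_leI gr0I even_zero)
    moreover have "M - 1 \<le> card (J - cut G {b})"
    proof (rule less.hyps[OF smaller rooted_star_con])
      show "join star_con (proj U \<triangle> proj W) (J - cut G {b})"
        by (rule join_star_con[OF less.prems(3,6)])
      show "proj W \<subseteq> verts star_con" by (rule proj_subset[OF less.prems(3)])
      show "odd (card (proj W))" using proj_odd_card[OF less.prems(3)] less.prems(5) by simp
      show "lev star_con (proj U) v \<le> M - 1" if "v \<in> verts star_con" for v
      proof -
        have v: "v \<in> verts G" "con v = v" using that by (auto simp: con_def)
        then show ?thesis
          using lev_star_con[OF v(1)] less.prems(2)[OF v(1)] bM by (cases "v = b") auto
      qed
      show "lev star_con (proj U) v = M - 1" if v: "v \<in> proj W" for v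
      proof -
        obtain w where w: "w \<in> W" "v = con w"
        proof (cases "v = b")
          \<comment> \<open>The merged vertex can only enter through a neighbour of \<open>b\<close>
            in \<open>W\<close>, and that neighbour has level \<open>M\<close>, which falls to
            \<open>M - 1\<close>.\<close>
          case True
          have "v \<notin> W - insert b N" using True by simp
          then have "odd (card (W \<inter> insert b N))" using v by (auto simp: proj_def split: if_splits)
          then have "W \<inter> insert b N \<noteq> {}" by (metis card.empty even_zero)
          then obtain w where "w \<in> W" "w \<in> N" using bW by auto
          then show thesis using that True by (simp add: con_def)
        next
          case False
          then have "v \<in> W" "v \<notin> N" using v by (auto simp: proj_def split: if_splits)
          then show thesis using that[of v] by (simp add: con_def)
        qed
        then have "w \<in> verts G" "w \<noteq> b" using less.prems(3) bW by auto
        then show ?thesis using lev_star_con[of w] less.prems(4)[OF w(1)] w(2) by simp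
      qed
    qed
    moreover have "card J = card (J \<inter> cut G {b}) + card (J - cut G {b})"
      using card_Int_Diff[of J "cut G {b}"] finite_join[OF graph(1) JE] by simp
    ultimately show ?thesis by linarith
  qed
qed

section \<open>Contraction of disjoint blocks\<close>

lemma contract_vertex_in:
  assumes "disjoint_family_on Y B" "v \<in> B" "x \<in> Y v"
  shows "contract_vertex B Y x = v"
proof -
  have "(THE v. v \<in> B \<and> x \<in> Y v) = v"
    using assms by (intro the_equality) (auto simp: disjoint_family_on_def)
  then show ?thesis using assms by (auto simp: contract_vertex_def)
qed

lemma contract_vertex_out: "x \<notin> (\<Union>v\<in>B. Y v) \<Longrightarrow> contract_vertex B Y x = x"
  by (auto simp: contract_vertex_def)

text \<open>Odd values are at least one, so a total of at most \<open>card B + 1\<close> leaves each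
  value at most two, and parity excludes two. The slack of one is used when a defect inside a block
  takes the place of a crossing edge.\<close>

lemma sum_odd_eq_one:
  fixes f :: "'a \<Rightarrow> nat"
  assumes "finite B" "\<And>v. v \<in> B \<Longrightarrow> odd (f v)" "sum f B \<le> card B + 1" "v \<in> B"
  shows "f v = 1"
proof -
  have "(\<Sum>w\<in>B - {v}. 1) \<le> sum f (B - {v})"
    using assms(2) by (intro sum_mono) (auto intro: odd_pos simp: Suc_le_eq)
  moreover have "sum f B = f v + sum f (B - {v})" using assms(1,4) by (rule sum.remove)
  moreover have "card B = Suc (card (B - {v}))" using assms(1,4) by (rule card.remove)
  ultimately have "f v \<le> 2" using assms(3) by simp
  then show ?thesis using assms(2)[OF assms(4)] by presburger
qed

text \<open>The setting shared by both directions: disjoint induced blocks, with every other edge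
  joining \<open>A\<close> to a block. Terminals, combs and primality are left out, since one
  direction assumes them and the other constructs them.\<close>

locale blocks =
  fixes G G' :: "('a, 'e) mgraph" and A B :: "'a set" and H :: "'a \<Rightarrow> ('a, 'e) mgraph"
  assumes fin: "finite_mgraph G" and finB: "finite B"
    and sub: "v \<in> B \<Longrightarrow> subgraph (H v) G"
    and edges_H: "v \<in> B \<Longrightarrow> edges (H v) = {e \<in> edges G. ends G e \<subseteq> verts (H v)}"
    and disj: "disjoint_family_on (\<lambda>v. verts (H v)) B"
    and new: "B \<inter> verts G = {}"
    and A_eq: "A = verts G - (\<Union>v\<in>B. verts (H v))"
    and same: "same_graph (contract_graph G B (\<lambda>v. verts (H v))) G'"
    and edge_cases: "\<lbrakk>e \<in> edges G; \<And>v. v \<in> B \<Longrightarrow> \<not> ends G e \<subseteq> verts (H v)\<rbrakk> \<Longrightarrow>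
      \<exists>a\<in>A. \<exists>v\<in>B. \<exists>y\<in>verts (H v). ends G e = {a, y}"
begin

abbreviation Y :: "'a \<Rightarrow> 'a set" where "Y v \<equiv> verts (H v)"

abbreviation ct :: "'a set \<Rightarrow> 'a set" where "ct W \<equiv> contract_terminals W B Y"

lemma Y_sub: "v \<in> B \<Longrightarrow> Y v \<subseteq> verts G"
  using sub by (auto simp: subgraph_def)

lemma fin_sets: "finite (verts G)" "finite (edges G)" "v \<in> B \<Longrightarrow> finite (Y v)"
  using fin Y_sub by (auto simp: finite_mgraph_def intro: finite_subset)

lemma A_props: "A \<subseteq> verts G" "A \<inter> B = {}" "v \<in> B \<Longrightarrow> A \<inter> Y v = {}"
  using A_eq new by auto

lemma Y_disj: "\<lbrakk>v \<in> B; w \<in> B; x \<in> Y v; x \<in> Y w\<rbrakk> \<Longrightarrow> v = w"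
  using disj by (auto simp: disjoint_family_on_def)

lemma verts_cases:
  assumes "x \<in> verts G"
  obtains "x \<in> A" | v where "v \<in> B" "x \<in> Y v"
  using assms A_eq by auto

lemma verts_G': "verts G' = A \<union> B"
  using same A_eq by (auto simp: same_graph_def contract_graph_def)

lemma edges_G': "edges G' = {e \<in> edges G. \<forall>v\<in>B. \<not> ends G e \<subseteq> Y v}"
  using same by (auto simp: same_graph_def contract_graph_def)

lemma edges_G'_sub: "edges G' \<subseteq> edges G"
  using edges_G' by auto

lemma edge_G'E:
  assumes "e \<in> edges G'"
  obtains a v y where "a \<in> A" "v \<in> B" "y \<in> Y v" "ends G e = {a, y}" "ends G' e = {a, v}"
proof -
  obtain a v y where *: "a \<in> A" "v \<in> B" "y \<in> Y v" "ends G e = {a, y}"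
    using edge_cases[of e] assms edges_G' by auto
  have "ends G' e = contract_vertex B Y ` ends G e"
    using same assms edges_G' unfolding same_graph_def contract_graph_def by auto
  also have "\<dots> = {a, v}"
    using contract_vertex_in[OF disj *(2,3)] contract_vertex_out[of a Y B] * A_eq by simp
  finally show thesis using that * by blast
qed

lemma colour_classes_G': "colour_classes G' A B"
proof (rule colour_classesI)
  show "\<exists>a\<in>A. \<exists>b\<in>B. ends G' e = {a, b}" if "e \<in> edges G'" for e
    using edge_G'E[OF that] by metis
qed (use A_props verts_G' in auto)

lemma finite_mgraph_G': "finite_mgraph G'"
proof -
  have "ends G' e \<subseteq> verts G' \<and> card (ends G' e) = 2" if e: "e \<in> edges G'" for e
  proof -
    obtain a v where "a \<in> A" "v \<in> B" "ends G' e = {a, v}" using edge_G'E[OF e] by metis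
    moreover have "a \<noteq> v" using \<open>a \<in> A\<close> \<open>v \<in> B\<close> A_props(2) by auto
    ultimately show ?thesis using verts_G' by auto
  qed
  moreover have "finite (verts G')" "finite (edges G')"
    using fin_sets finB A_props(1) edges_G'_sub verts_G' by (auto intro: finite_subset)
  ultimately show ?thesis by (auto simp: finite_mgraph_def)
qed

lemma ends_A: "\<lbrakk>e \<in> edges G'; a \<in> A\<rbrakk> \<Longrightarrow> a \<in> ends G' e \<longleftrightarrow> a \<in> ends G e"
  using edge_G'E A_props(2,3) by (metis disjoint_iff insert_iff singletonD)

lemma cut_Y_sub: "v \<in> B \<Longrightarrow> cut G (Y v) \<subseteq> edges G'"
proof
  fix e assume v: "v \<in> B" and e: "e \<in> cut G (Y v)"
  have eE: "e \<in> edges G" using e cut_subset by fast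
  obtain x y where xy: "ends G e = {x, y}" using ends_doubleton[OF fin eE] by metis
  have "(x \<in> Y v) \<noteq> (y \<in> Y v)" using in_cut_iff[OF fin eE xy] e by simp
  then have "\<not> ends G e \<subseteq> Y w" if "w \<in> B" for w
    using xy v that Y_disj by blast
  then show "e \<in> edges G'" using eE edges_G' by auto
qed

lemma ends_B: "\<lbrakk>e \<in> edges G'; v \<in> B\<rbrakk> \<Longrightarrow> v \<in> ends G' e \<longleftrightarrow> e \<in> cut G (Y v)"
proof -
  assume e: "e \<in> edges G'" and v: "v \<in> B"
  obtain a w y where *: "a \<in> A" "w \<in> B" "y \<in> Y w" "ends G e = {a, y}" "ends G' e = {a, w}"
    using edge_G'E[OF e] by metis
  have "e \<in> cut G (Y v) \<longleftrightarrow> y \<in> Y v"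
    using in_cut_iff[OF fin _ *(4)] e edges_G'_sub A_props(3)[OF v] *(1) by blast
  moreover have "v \<noteq> a" using v *(1) A_props(2) by auto
  ultimately show ?thesis using *(2,3,5) v Y_disj by auto
qed

lemma cut_G'_single:
  assumes "v \<in> B"
  shows "cut G' {v} = cut G (Y v)"
proof -
  have "e \<in> cut G' {v} \<longleftrightarrow> e \<in> cut G (Y v)" if "e \<in> edges G'" for e
    using in_cut_single_iff[OF finite_mgraph_G' that, of v] ends_B[OF that assms] by simp
  then show ?thesis using cut_Y_sub[OF assms] cut_subset[of G' "{v}"] by blast
qed

lemma edges_H_disjoint:
  assumes "v \<in> B" "w \<in> B" "v \<noteq> w"
  shows "edges (H v) \<inter> edges (H w) = {}"
proof (rule ccontr)
  assume "edges (H v) \<inter> edges (H w) \<noteq> {}"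
  then obtain e where e: "e \<in> edges G" "ends G e \<subseteq> Y v" "ends G e \<subseteq> Y w"
    using edges_H assms by auto
  obtain x y where "ends G e = {x, y}" using ends_doubleton[OF fin e(1)] by metis
  then show False using e Y_disj assms by auto
qed

text \<open>An edge of \<open>G'\<close> has one end in \<open>A\<close>, so it crosses the boundary
  of exactly one block; every other edge lies inside exactly one block.\<close>

lemma card_decomp:
  assumes "J \<subseteq> edges G"
  shows "card J = (\<Sum>v\<in>B. card (J \<inter> cut G (Y v))) + (\<Sum>v\<in>B. card (J \<inter> edges (H v)))"
proof -
  have fJ: "finite J" using assms finite_join[OF fin] by auto
  have "J = (J \<inter> edges G') \<union> (\<Union>v\<in>B. J \<inter> edges (H v))"
    using assms edges_G' edges_H by auto
  moreover have "J \<inter> edges G' \<inter> (\<Union>v\<in>B. J \<inter> edges (H v)) = {}"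
    using edges_G' edges_H by auto
  ultimately have "card J = card (J \<inter> edges G') + card (\<Union>v\<in>B. J \<inter> edges (H v))"
    using fJ by (metis card_Un_disjoint finite_Un)
  moreover have "J \<inter> edges G' = (\<Union>v\<in>B. J \<inter> cut G (Y v))"
  proof -
    have "\<exists>v\<in>B. e \<in> cut G (Y v)" if e: "e \<in> edges G'" for e
      using edge_G'E[OF e] ends_B[OF e] by (metis insertI1 insert_commute)
    then show ?thesis using cut_Y_sub by blast
  qed
  moreover have "card (\<Union>v\<in>B. J \<inter> cut G (Y v)) = (\<Sum>v\<in>B. card (J \<inter> cut G (Y v)))"
  proof (rule card_UN_disjoint)
    show "\<forall>v\<in>B. \<forall>w\<in>B. v \<noteq> w \<longrightarrow> J \<inter> cut G (Y v) \<inter> (J \<inter> cut G (Y w)) = {}"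
    proof (intro ballI impI, rule ccontr)
      fix v w assume vw: "v \<in> B" "w \<in> B" "v \<noteq> w" "J \<inter> cut G (Y v) \<inter> (J \<inter> cut G (Y w)) \<noteq> {}"
      then obtain e where e: "e \<in> cut G (Y v)" "e \<in> cut G (Y w)" by auto
      have eG': "e \<in> edges G'" using cut_Y_sub vw(1) e(1) by auto
      obtain a u where "a \<in> A" "ends G' e = {a, u}" using edge_G'E[OF eG'] by metis
      moreover have "v \<in> ends G' e" "w \<in> ends G' e" using ends_B eG' vw e by auto
      ultimately show False using vw A_props(2) by auto
    qed
  qed (use finB fJ in auto)
  moreover have "card (\<Union>v\<in>B. J \<inter> edges (H v)) = (\<Sum>v\<in>B. card (J \<inter> edges (H v)))"
  proof (rule card_UN_disjoint)
    show "\<forall>v\<in>B. \<forall>w\<in>B. v \<noteq> w \<longrightarrow> J \<inter> edges (H v) \<inter> (J \<inter> edges (H w)) = {}"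
      using edges_H_disjoint by blast
  qed (use finB fJ in auto)
  ultimately show ?thesis by simp
qed

lemma ct_iff: "a \<in> A \<Longrightarrow> a \<in> ct W \<longleftrightarrow> a \<in> W" "v \<in> B \<Longrightarrow> W \<subseteq> verts G \<Longrightarrow> v \<in> ct W \<longleftrightarrow> odd (card (Y v \<inter> W))"
  using A_props A_eq new by (auto simp: contract_terminals_def)

lemma ct_sub: "W \<subseteq> verts G \<Longrightarrow> ct W \<subseteq> verts G'"
  using verts_G' A_eq by (auto simp: contract_terminals_def)

lemma join_G'_iff:
  assumes "J \<subseteq> edges G'"
  shows "join G' W J \<longleftrightarrow> (\<forall>a\<in>A. a \<in> W \<longleftrightarrow> odd (card {e \<in> J. a \<in> ends G e})) \<and>
    (\<forall>v\<in>B. v \<in> W \<longleftrightarrow> odd (card (J \<inter> cut G (Y v))))"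
proof -
  have "{e \<in> J. a \<in> ends G' e} = {e \<in> J. a \<in> ends G e}" if "a \<in> A" for a
    using ends_A that assms by blast
  moreover have "{e \<in> J. v \<in> ends G' e} = J \<inter> cut G (Y v)" if "v \<in> B" for v
    using ends_B that assms by blast
  ultimately show ?thesis using assms verts_G' by (auto simp: join_def ball_Un)
qed

lemma edges_at_Y:
  assumes "J \<subseteq> edges G'" "v \<in> B" "y \<in> Y v"
  shows "{e \<in> J. y \<in> ends G e} = {e \<in> J \<inter> cut G (Y v). y \<in> ends G e}"
proof -
  have "e \<in> cut G (Y v)" if e: "e \<in> J" "y \<in> ends G e" for e
  proof -
    have eG': "e \<in> edges G'" using e assms by auto
    obtain a w z where *: "a \<in> A" "w \<in> B" "z \<in> Y w" "ends G e = {a, z}" "ends G' e = {a, w}"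
      using edge_G'E[OF eG'] by metis
    have "y \<noteq> a" using *(1) assms A_props(3) by auto
    then have "w = v" using e(2) * assms(2,3) Y_disj by auto
    then show ?thesis using ends_B[OF eG' assms(2)] *(5) by auto
  qed
  then show ?thesis by auto
qed

lemma odd_verts_Y:
  assumes "J \<subseteq> edges G'" "v \<in> B"
  shows "odd_verts G J \<inter> Y v = odd_verts G (J \<inter> cut G (Y v)) \<inter> Y v"
  using edges_at_Y[OF assms] by (auto simp: odd_verts_def)

lemma edges_at_H:
  assumes "v \<in> B" "y \<in> Y v" "J \<subseteq> edges G"
  shows "{e \<in> J. y \<in> ends G e} = {e \<in> J \<inter> edges G'. y \<in> ends G e} \<union> {e \<in> J \<inter> edges (H v). y \<in> ends (H v) e}"
proof -
  have "e \<in> edges (H v)" if "e \<in> J" "y \<in> ends G e" "e \<notin> edges G'" for e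
  proof -
    have eE: "e \<in> edges G" using that assms by auto
    have "\<not> (\<forall>v\<in>B. \<not> ends G e \<subseteq> Y v)" using that(3) eE unfolding edges_G' by simp
    then obtain w where w: "w \<in> B" "ends G e \<subseteq> Y w" by auto
    then have "w = v" using Y_disj assms that(2) by auto
    then show ?thesis using w eE edges_H by auto
  qed
  moreover have "ends (H v) e = ends G e" if "e \<in> edges (H v)" for e
    using sub[OF assms(1)] that by (auto simp: subgraph_def)
  ultimately show ?thesis by auto
qed

text \<open>Vertices of \<open>A\<close> see only edges of \<open>G'\<close>. Inside a block, the
  edges arriving from outside toggle the demand at their ends, and the inner part has to serve the
  demand that remains. Joins can thus be cut and reassembled block by block.\<close>

lemma join_iff_blocks:
  assumes "W \<subseteq> verts G" "J \<subseteq> edges G"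
  shows "join G W J \<longleftrightarrow> (\<forall>a\<in>A. a \<in> W \<longleftrightarrow> odd (card {e \<in> J \<inter> edges G'. a \<in> ends G e})) \<and>
    (\<forall>v\<in>B. join (H v) ((W \<triangle> odd_verts G (J \<inter> edges G')) \<inter> Y v) (J \<inter> edges (H v)))"
proof -
  have fJ: "finite J" using assms finite_join[OF fin] by auto
  have a: "{e \<in> J. a \<in> ends G e} = {e \<in> J \<inter> edges G'. a \<in> ends G e}" if "a \<in> A" for a
    using that assms A_props(3) edges_G' by blast
  have y: "odd (card {e \<in> J. y \<in> ends G e}) \<longleftrightarrow>
      (y \<in> odd_verts G (J \<inter> edges G')) \<noteq> odd (card {e \<in> J \<inter> edges (H v). y \<in> ends (H v) e})"
    if v: "v \<in> B" "y \<in> Y v" for v y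
  proof -
    have "{e \<in> J \<inter> edges G'. y \<in> ends G e} \<inter> {e \<in> J \<inter> edges (H v). y \<in> ends (H v) e} = {}"
      using edges_G' edges_H v by auto
    then have "card {e \<in> J. y \<in> ends G e} =
      card {e \<in> J \<inter> edges G'. y \<in> ends G e} + card {e \<in> J \<inter> edges (H v). y \<in> ends (H v) e}"
      unfolding edges_at_H[OF v assms(2)] using fJ by (intro card_Un_disjoint) auto
    moreover have "y \<in> verts G" using Y_sub v by auto
    ultimately show ?thesis by (simp add: odd_verts_def)
  qed
  have "join G W J \<longleftrightarrow> (\<forall>x\<in>verts G. odd (card {e \<in> J. x \<in> ends G e}) \<longleftrightarrow> x \<in> W)"
    using assms(2) by (simp add: join_def)
  also have "\<dots> \<longleftrightarrow> (\<forall>x\<in>A. odd (card {e \<in> J. x \<in> ends G e}) \<longleftrightarrow> x \<in> W) \<and>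
      (\<forall>v\<in>B. \<forall>y\<in>Y v. odd (card {e \<in> J. y \<in> ends G e}) \<longleftrightarrow> y \<in> W)"
  proof -
    have V: "verts G = A \<union> (\<Union>v\<in>B. Y v)" using A_eq Y_sub by auto
    show ?thesis unfolding V by blast
  qed
  also have "\<dots> \<longleftrightarrow> (\<forall>a\<in>A. a \<in> W \<longleftrightarrow> odd (card {e \<in> J \<inter> edges G'. a \<in> ends G e})) \<and>
    (\<forall>v\<in>B. join (H v) ((W \<triangle> odd_verts G (J \<inter> edges G')) \<inter> Y v) (J \<inter> edges (H v)))"
    using a y by (auto simp: join_def)
  finally show ?thesis .
qed

lemma cut_Y_parity:
  assumes "W \<subseteq> verts G" "join G W J" "v \<in> B"
  shows "odd (card (J \<inter> cut G (Y v))) \<longleftrightarrow> odd (card (Y v \<inter> W))"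
  using assms cut_parity[OF fin _ fin_sets(3)[OF assms(3)]] by (simp add: join_iff Int_commute)

lemma join_contract:
  assumes "W \<subseteq> verts G" "join G W J"
  shows "join G' (ct W) (J \<inter> edges G')"
proof -
  have J: "J \<subseteq> edges G" using assms(2) by (simp add: join_def)
  have "J \<inter> edges G' \<inter> cut G (Y v) = J \<inter> cut G (Y v)" if "v \<in> B" for v
    using cut_Y_sub[OF that] by auto
  then show ?thesis
    using cut_Y_parity[OF assms] assms join_iff_blocks[OF assms(1) J] ct_iff
    by (subst join_G'_iff) auto
qed

lemma card_G'_join:
  assumes "J \<subseteq> edges G'"
  shows "card J = (\<Sum>v\<in>B. card (J \<inter> cut G (Y v)))"
proof -
  have "J \<inter> edges (H v) = {}" if "v \<in> B" for v using assms edges_G' edges_H that by auto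
  then show ?thesis using card_decomp[of J] assms edges_G'_sub by auto
qed

lemma ct_xor:
  assumes "W \<subseteq> verts G" "x \<in> verts G"
  shows "ct (W \<triangle> {x}) = ct W \<triangle> {contract_vertex B Y x}"
proof -
  have V: "W \<triangle> {x} \<subseteq> verts G" using assms by auto
  have "z \<in> ct (W \<triangle> {x}) \<longleftrightarrow> z \<in> ct W \<triangle> {contract_vertex B Y x}" if "z \<in> A \<union> B" for z
  proof -
    have out: "contract_vertex B Y x = x" if "x \<in> A"
      using that A_eq by (intro contract_vertex_out) auto
    show ?thesis
    proof (cases "z \<in> A")
      case True
      have "z = contract_vertex B Y x \<longleftrightarrow> z = x"
        by (rule verts_cases[OF assms(2)]) (use True out A_props contract_vertex_in[OF disj] in auto)
      then show ?thesis using True ct_iff(1) by auto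
    next
      case False
      then have z: "z \<in> B" using that by auto
      have "z = contract_vertex B Y x \<longleftrightarrow> x \<in> Y z"
        by (rule verts_cases[OF assms(2)])
          (use z out A_props contract_vertex_in[OF disj] Y_disj in auto)
      moreover have "Y z \<inter> (W \<triangle> {x}) = (Y z \<inter> W) \<triangle> (Y z \<inter> {x})" by auto
      moreover have "odd (card (Y z \<inter> {x})) \<longleftrightarrow> x \<in> Y z" by (cases "x \<in> Y z") auto
      ultimately show ?thesis
        using ct_iff(2)[OF z V] ct_iff(2)[OF z assms(1)] fin_sets(3)[OF z] by (auto simp: odd_card_xor)
    qed
  qed
  moreover have "ct (W \<triangle> {x}) \<subseteq> A \<union> B" "ct W \<triangle> {contract_vertex B Y x} \<subseteq> A \<union> B"
  proof -
    have "contract_vertex B Y x \<in> A \<union> B"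
      by (rule verts_cases[OF assms(2)])
        (use contract_vertex_in[OF disj] contract_vertex_out[of x Y B] A_eq in auto)
    then show "ct (W \<triangle> {x}) \<subseteq> A \<union> B" "ct W \<triangle> {contract_vertex B Y x} \<subseteq> A \<union> B"
      using ct_sub[OF V] ct_sub[OF assms(1)] verts_G' by auto
  qed
  ultimately show ?thesis by blast
qed

end

section \<open>Primal grafts and syntheses\<close>

lemma primal_rooted:
  assumes "graft G T" "bipartite G" "primal G T r"
  shows "rooted G (T \<triangle> {r})" "x \<in> verts G \<Longrightarrow> lev G (T \<triangle> {r}) x \<le> tau G T"
    "root_level G T r = {x \<in> verts G. lev G (T \<triangle> {r}) x = tau G T}"
    "lev G (T \<triangle> {r}) r = tau G T"
proof -
  have r: "r \<in> verts G"
    and *: "\<And>x. x \<in> verts G \<Longrightarrow> \<exists>J. join G (T \<triangle> {r} \<triangle> {x}) J \<and> card J \<le> tau G T"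
    using assms(3) unfolding primal_iff[OF assms(1)] by blast+
  show "x \<in> verts G \<Longrightarrow> lev G (T \<triangle> {r}) x \<le> tau G T"
    using * lev_le le_trans by metis
  have "T \<triangle> {r} \<subseteq> verts G" using assms(1) r by (intro xor_subset) (auto simp: graft_def)
  then show "rooted G (T \<triangle> {r})"
    using assms(1,2) * unfolding rooted_def graft_def by blast
  show "root_level G T r = {x \<in> verts G. lev G (T \<triangle> {r}) x = tau G T}"
    unfolding lev_def by (rule root_level_eq[OF assms(1,3)])
  show "lev G (T \<triangle> {r}) r = tau G T" by (simp add: lev_def)
qed

section \<open>A synthesis over a primal comb is primal\<close>

context blocks
begin

text \<open>Every edge of the comb has exactly one end in \<open>B\<close>, so counting edges at the
  vertices of \<open>B\<close> counts the whole join. Degree one is odd, so each of these vertices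
  is a terminal.\<close>

lemma comb_tau:
  assumes "comb G' T' A B" "minimum_join G' T' F"
  shows "tau G' T' = card B" "B \<subseteq> T'"
proof -
  have F: "join G' T' F" "card F = tau G' T'" "F \<subseteq> edges G'"
    using assms(2) unfolding minimum_join_iff by (simp_all add: join_def)
  have one: "card (F \<inter> cut G (Y v)) = 1" if "v \<in> B" for v
  proof -
    have "card (cut G' {v} \<inter> F) = 1" using assms that unfolding comb_def by blast
    then show ?thesis unfolding cut_G'_single[OF that] by (simp add: Int_commute)
  qed
  then show "tau G' T' = card B" using card_G'_join[OF F(3)] F(2) by simp
  show "B \<subseteq> T'" using F(1) one unfolding join_G'_iff[OF F(3)] by auto
qed

text \<open>Both bounds are obtained for the number \<open>card B + sum h B\<close>. Any
  \<open>T\<close>-join crosses each tooth oddly and attaches only at its top level, so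
  \<open>top_level_join_bound\<close> applies inside. Conversely, a join of the comb with at most
  \<open>card B\<close> edges fixes one defect per tooth, which a join of the tooth repairs at cost
  at most \<open>h v\<close>.\<close>

lemma synthesis_primal:
  assumes T: "T \<subseteq> verts G" and comb: "comb G' T' A B" and primal': "primal G' T' r" and r: "r \<in> A"
    and tooth: "\<And>v. v \<in> B \<Longrightarrow> tooth_graft (H v) (S v) (s v)"
    and TY: "\<And>v. v \<in> B \<Longrightarrow> T \<inter> Y v = S v \<triangle> {s v}"
    and ctT: "ct T = T'"
    and cuts: "\<And>v. v \<in> B \<Longrightarrow> cut G (Y v) = edges_between G A (root_level (H v) (S v) (s v))"
  shows "primal G T r"
proof -
  define h where "h v = tau (H v) (S v)" for v
  have graft': "graft G' T'" using comb by (simp add: comb_def)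
  obtain F' where "minimum_join G' T' F'" using primal' unfolding primal_def by blast
  note tau' = comb_tau[OF comb this]
  have oddT: "odd (card (Y v \<inter> T))" if "v \<in> B" for v
    using subsetD[OF tau'(2) that] ct_iff(2)[OF that T] unfolding ctT by simp
  have tg: "graft (H v) (S v)" "bipartite (H v)" "primal (H v) (S v) (s v)" if "v \<in> B" for v
    using tooth[OF that] unfolding tooth_graft_def bipartite_def by blast+
  \<comment> \<open>The terminals of the tooth are those of \<open>T\<close> up to toggling its
    root, so \<open>T \<inter> Y v\<close> plays inside the tooth the part that \<open>U\<close>
    plays in a primal graft.\<close>
  have H: "rooted (H v) (T \<inter> Y v)"
    "\<And>x. x \<in> Y v \<Longrightarrow> lev (H v) (T \<inter> Y v) x \<le> h v"
    "root_level (H v) (S v) (s v) = {x \<in> Y v. lev (H v) (T \<inter> Y v) x = h v}" if "v \<in> B" for v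
    using primal_rooted[OF tg[OF that]] TY[OF that] by (simp_all add: h_def)
  have cutE: "\<exists>a z. ends G e = {a, z} \<and> a \<in> A \<and> z \<in> Y v \<and> lev (H v) (T \<inter> Y v) z = h v"
    if "v \<in> B" "e \<in> cut G (Y v)" for v e
    using that cuts[OF that(1)] H(3)[OF that(1)] by (auto simp: edges_between_def)
  have lower: "card B + sum h B \<le> card J" if J: "join G T J" for J
  proof -
    have JE: "J \<subseteq> edges G" using J by (simp add: join_def)
    have odd_cut: "odd (card (J \<inter> cut G (Y v)))" if "v \<in> B" for v
      using cut_Y_parity[OF T J that] oddT[OF that] by simp
    have "h v \<le> card (J \<inter> edges (H v))" if v: "v \<in> B" for v
    proof -
      let ?J = "J \<inter> edges G'"
      let ?W = "odd_verts G ?J \<inter> Y v"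
      have "join (H v) ((T \<triangle> odd_verts G ?J) \<inter> Y v) (J \<inter> edges (H v))"
        using join_iff_blocks[OF T JE] J v by auto
      then have j: "join (H v) (T \<inter> Y v \<triangle> ?W) (J \<inter> edges (H v))" by (simp add: xor_Int)
      have "?J \<inter> cut G (Y v) = J \<inter> cut G (Y v)" using cut_Y_sub[OF v] by auto
      then have "odd (card ?W)"
        using cut_parity[OF fin, of ?J "Y v"] fin_sets(3)[OF v] odd_cut[OF v] JE by auto
      \<comment> \<open>A vertex of \<open>?W\<close> is an end of a crossing edge, and the
        synthesis attaches such edges only at the root level of the tooth.\<close>
      moreover have "lev (H v) (T \<inter> Y v) w = h v" if w: "w \<in> ?W" for w
      proof -
        have "odd (card {e \<in> ?J. w \<in> ends G e})" using w by (simp add: odd_verts_def)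
        then have "{e \<in> ?J. w \<in> ends G e} \<noteq> {}" by (metis card.empty even_zero)
        moreover have "{e \<in> ?J. w \<in> ends G e} = {e \<in> ?J \<inter> cut G (Y v). w \<in> ends G e}"
          using w by (intro edges_at_Y v) auto
        ultimately obtain e where e: "e \<in> cut G (Y v)" "w \<in> ends G e" by blast
        obtain a z where "ends G e = {a, z}" "a \<in> A" "z \<in> Y v" "lev (H v) (T \<inter> Y v) z = h v"
          using cutE[OF v e(1)] by metis
        moreover have "a \<notin> Y v" using \<open>a \<in> A\<close> A_props(3)[OF v] by auto
        ultimately show ?thesis using e(2) w by auto
      qed
      ultimately show ?thesis
        using top_level_join_bound[OF H(1,2)[OF v] _ _ _ j] by blast
    qed
    moreover have "1 \<le> card (J \<inter> cut G (Y v))" if "v \<in> B" for v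
      using odd_cut[OF that] by (simp add: odd_pos Suc_le_eq)
    ultimately have "(\<Sum>v\<in>B. 1) + sum h B \<le> card J"
      unfolding card_decomp[OF JE] by (intro add_mono sum_mono) auto
    then show ?thesis by simp
  qed
  have upper: "\<exists>J. join G (T \<triangle> {r} \<triangle> {x}) J \<and> card J \<le> card B + sum h B" if x: "x \<in> verts G" for x
  proof -
    let ?W = "T \<triangle> {r} \<triangle> {x}"
    let ?x = "contract_vertex B Y x"
    have rV: "r \<in> verts G" using r A_props(1) by auto
    have W: "?W \<subseteq> verts G" "T \<triangle> {r} \<subseteq> verts G" using T x rV by auto
    have xV: "?x \<in> verts G'"
      by (rule verts_cases[OF x])
        (use contract_vertex_in[OF disj] contract_vertex_out[of x Y B] A_eq verts_G' in auto)
    have "contract_vertex B Y r = r" using r A_eq by (intro contract_vertex_out) auto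
    then have "ct ?W = T' \<triangle> {r} \<triangle> {?x}"
      using ct_xor[OF W(2) x] ct_xor[OF T rV] ctT by simp
    moreover have "\<exists>J. join G' (T' \<triangle> {r} \<triangle> {?x}) J \<and> card J \<le> card B"
      using primal' xV unfolding primal_iff[OF graft'] tau'(1) by blast
    ultimately obtain J' where J': "join G' (ct ?W) J'" "card J' \<le> card B"
      by auto
    have J'E: "J' \<subseteq> edges G'" using J' by (simp add: join_def)
    have fJ': "finite J'" using J'E finite_join finite_mgraph_G' by metis
    have WY: "?W \<inter> Y v = (if x \<in> Y v then T \<inter> Y v \<triangle> {x} else T \<inter> Y v)" if "v \<in> B" for v
      using A_props(3)[OF that] r by auto
    define f where "f v = card (J' \<inter> cut G (Y v))" for v
    \<comment> \<open>Each tooth is crossed oddly by \<open>J'\<close>, except that the parity flips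
      for the tooth containing \<open>x\<close>. Counting \<open>x\<close> as one more edge of its
      tooth makes all numbers odd, and their total is at most \<open>card B + 1\<close>.\<close>
    have one: "f v + (if x \<in> Y v then 1 else 0) = 1" if v: "v \<in> B" for v
    proof (rule sum_odd_eq_one[OF finB _ _ v])
      show "odd (f v + (if x \<in> Y v then 1 else 0))" if v: "v \<in> B" for v
      proof -
        have "odd (f v) \<longleftrightarrow> odd (card (?W \<inter> Y v))"
          using J'(1) v ct_iff(2)[OF v W(1)] unfolding join_G'_iff[OF J'E] f_def by (simp add: Int_commute)
        moreover have "finite (T \<inter> Y v)" using fin_sets(3)[OF v] by auto
        ultimately show ?thesis using oddT[OF v] WY[OF v] by (auto simp: odd_card_xor Int_commute)
      qed
      have "(\<Sum>v\<in>B. if x \<in> Y v then 1 else 0) \<le> (1::nat)"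
      proof (rule verts_cases[OF x])
        assume "x \<in> A"
        then have "(\<Sum>v\<in>B. if x \<in> Y v then 1 else 0) = (\<Sum>v\<in>B. 0::nat)"
          using A_props(3) by (intro sum.cong) auto
        then show ?thesis by simp
      next
        fix w assume w: "w \<in> B" "x \<in> Y w"
        then have "(\<Sum>v\<in>B. if x \<in> Y v then 1 else 0) = (\<Sum>v\<in>B. if v = w then 1 else 0::nat)"
          using Y_disj by (intro sum.cong) auto
        then show ?thesis using w finB by simp
      qed
      moreover have "sum f B \<le> card B" using card_G'_join[OF J'E] J'(2) by (simp add: f_def)
      ultimately show "(\<Sum>v\<in>B. f v + (if x \<in> Y v then 1 else 0)) \<le> card B + 1"
        by (simp add: sum.distrib)
    qed
    have f: "f v = (if x \<in> Y v then 0 else 1)" if "v \<in> B" for v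
      using one[OF that] by (simp split: if_splits)
    have "\<forall>v\<in>B. \<exists>K. join (H v) ((?W \<triangle> odd_verts G J') \<inter> Y v) K \<and> card K \<le> h v"
    proof
      fix v assume v: "v \<in> B"
      have od: "odd_verts G J' \<inter> Y v = odd_verts G (J' \<inter> cut G (Y v)) \<inter> Y v"
        by (rule odd_verts_Y[OF J'E v])
      \<comment> \<open>The defect of the tooth is \<open>x\<close> itself if \<open>x\<close> lies
        in it, since then no edge of \<open>J'\<close> crosses; otherwise it is the end of the
        single crossing edge.\<close>
      obtain z where z: "z \<in> Y v" "(?W \<triangle> odd_verts G J') \<inter> Y v = (T \<inter> Y v) \<triangle> {z}"
      proof (cases "x \<in> Y v")
        case True
        then have "J' \<inter> cut G (Y v) = {}" using f[OF v] fJ' by (simp add: f_def)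
        then have "odd_verts G J' \<inter> Y v = {}" using od by simp
        then have "(?W \<triangle> odd_verts G J') \<inter> Y v = (T \<inter> Y v) \<triangle> {x}"
          using WY[OF v] True unfolding xor_Int[of ?W] by simp
        then show thesis using that True by blast
      next
        case False
        then have "card (J' \<inter> cut G (Y v)) = 1" using f[OF v] by (simp add: f_def)
        then obtain e where e: "J' \<inter> cut G (Y v) = {e}" by (rule card_1_singletonE)
        then have eC: "e \<in> cut G (Y v)" by auto
        obtain a z where az: "ends G e = {a, z}" "a \<in> A" "z \<in> Y v"
          using cutE[OF v eC] by metis
        have "e \<in> edges G" using eC cut_subset by fast
        then have "odd_verts G J' \<inter> Y v = {a, z} \<inter> Y v"
          using od e odd_verts_single[OF fin] az(1) by simp
        also have "\<dots> = {z}" using az A_props(3)[OF v] by auto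
        finally have "(?W \<triangle> odd_verts G J') \<inter> Y v = (T \<inter> Y v) \<triangle> {z}"
          using WY[OF v] False unfolding xor_Int[of ?W] by simp
        then show thesis using that az(3) by blast
      qed
      obtain K where "join (H v) (T \<inter> Y v \<triangle> {z}) K" "card K = lev (H v) (T \<inter> Y v) z"
        using lev_attained[OF H(1)[OF v] z(1)] by metis
      then show "\<exists>K. join (H v) ((?W \<triangle> odd_verts G J') \<inter> Y v) K \<and> card K \<le> h v"
        unfolding z(2) using H(2)[OF v z(1)] by auto
    qed
    from bchoice[OF this] obtain K
      where K: "\<And>v. v \<in> B \<Longrightarrow> join (H v) ((?W \<triangle> odd_verts G J') \<inter> Y v) (K v)"
        "\<And>v. v \<in> B \<Longrightarrow> card (K v) \<le> h v"
      by blast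
    let ?J = "J' \<union> (\<Union>v\<in>B. K v)"
    have KE: "K v \<subseteq> edges (H v)" if "v \<in> B" for v using K(1)[OF that] by (simp add: join_def)
    have HG': "edges (H v) \<inter> edges G' = {}" if "v \<in> B" for v using edges_G' edges_H[OF that] that by auto
    have "K v \<subseteq> edges G" if "v \<in> B" for v using KE[OF that] edges_H[OF that] by auto
    then have JE: "?J \<subseteq> edges G" using order_trans[OF J'E edges_G'_sub] by (intro Un_least UN_least)
    have "K v \<inter> edges G' = {}" if "v \<in> B" for v using KE[OF that] HG'[OF that] by auto
    then have J1: "?J \<inter> edges G' = J'" using J'E by blast
    have J2: "?J \<inter> edges (H v) = K v" if "v \<in> B" for v
    proof -
      have "J' \<inter> edges (H v) = {}" using J'E HG'[OF that] by auto
      moreover have "K w \<inter> edges (H v) = (if w = v then K v else {})" if "w \<in> B" for w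
        using KE[OF that] edges_H_disjoint[OF that \<open>v \<in> B\<close>] by auto
      moreover have "?J \<inter> edges (H v) = (J' \<inter> edges (H v)) \<union> (\<Union>w\<in>B. K w \<inter> edges (H v))" by blast
      ultimately have "?J \<inter> edges (H v) = (\<Union>w\<in>B. if w = v then K v else {})" by simp
      then show ?thesis using \<open>v \<in> B\<close> by (auto split: if_splits)
    qed
    have "a \<in> ?W \<longleftrightarrow> odd (card {e \<in> J'. a \<in> ends G e})" if "a \<in> A" for a
    proof -
      have "a \<in> ct ?W \<longleftrightarrow> odd (card {e \<in> J'. a \<in> ends G e})"
        using J'(1) that unfolding join_G'_iff[OF J'E] by blast
      then show ?thesis using ct_iff(1)[OF that, of ?W] by blast
    qed
    moreover have "join (H v) ((?W \<triangle> odd_verts G J') \<inter> Y v) (?J \<inter> edges (H v))" if "v \<in> B" for v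
      using K(1)[OF that] unfolding J2[OF that] .
    ultimately have "join G ?W ?J"
      unfolding join_iff_blocks[OF W(1) JE] J1 by blast
    moreover have "card ?J \<le> card B + sum h B"
    proof -
      have "?J \<inter> cut G (Y v) = J' \<inter> cut G (Y v)" if "v \<in> B" for v
        using J1 cut_Y_sub[OF that] by blast
      then have "card ?J = card J' + (\<Sum>v\<in>B. card (K v))"
        unfolding card_decomp[OF JE] card_G'_join[OF J'E] using J2 by (simp cong: sum.cong)
      moreover have "(\<Sum>v\<in>B. card (K v)) \<le> sum h B" using K(2) by (rule sum_mono)
      ultimately show ?thesis using J'(2) by linarith
    qed
    ultimately show ?thesis by blast
  qed
  have rV: "r \<in> verts G" using r A_props(1) by auto
  have "\<exists>J. join G T J" using upper[OF rV] by auto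
  then obtain J where "join G T J" "card J = tau G T" using tau_attained by metis
  then have "card B + sum h B \<le> tau G T" using lower by metis
  moreover have grG: "graft G T" using T fin by (simp add: graft_def)
  ultimately have "\<exists>J. join G (T \<triangle> {r} \<triangle> {x}) J \<and> card J \<le> tau G T" if "x \<in> verts G" for x
    using upper[OF that] by (meson order_trans)
  then show ?thesis unfolding primal_iff[OF grG] using rV by blast
qed

end


section \<open>Components below a level\<close>

lemma level_components:
  assumes "rooted G U"
  obtains \<D> where "finite \<D>" "\<And>D. D \<in> \<D> \<Longrightarrow> level_comp G U k D"
    "\<And>C D. \<lbrakk>C \<in> \<D>; D \<in> \<D>; C \<inter> D \<noteq> {}\<rbrakk> \<Longrightarrow> C = D" "\<Union>\<D> = {x \<in> verts G. lev G U x < k}"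
proof
  have G: "finite_mgraph G" using assms by (simp add: rooted_def)
  define V where "V = {x \<in> verts G. lev G U x < k}"
  define R where "R = {(u, v). u \<in> V \<and> v \<in> V \<and> (\<exists>e\<in>edges G. ends G e = {u, v})}"
  let ?C = "\<lambda>u. R\<^sup>* `` {u}"
  have "sym R" unfolding R_def sym_def by (auto simp: insert_commute)
  then have symR: "(v, u) \<in> R\<^sup>*" if "(u, v) \<in> R\<^sup>*" for u v
    using that sym_rtrancl by (metis symD)
  have inV: "v \<in> V" if "(u, v) \<in> R\<^sup>*" "u \<in> V" for u v
    using that by (induction rule: rtrancl_induct) (auto simp: R_def)
  have "finite V" using G by (simp add: V_def finite_mgraph_def)
  then show "finite (?C ` V)" by simp
  show "C = D" if "C \<in> ?C ` V" "D \<in> ?C ` V" "C \<inter> D \<noteq> {}" for C D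
  proof -
    obtain u v w where "C = ?C u" "D = ?C v" "(u, w) \<in> R\<^sup>*" "(v, w) \<in> R\<^sup>*" using \<open>C \<in> _\<close> \<open>D \<in> _\<close> \<open>C \<inter> D \<noteq> {}\<close> by blast
    then show ?thesis using symR by (meson Image_singleton_iff rtrancl_trans set_eqI)
  qed
  show "\<Union>(?C ` V) = {x \<in> verts G. lev G U x < k}"
    unfolding V_def[symmetric] using inV by blast
  show "level_comp G U k D" if D: "D \<in> ?C ` V" for D
  proof -
    obtain u where u: "u \<in> V" "D = ?C u" using D by auto
    have DV: "D \<subseteq> V" using inV u by auto
    have closed: "v \<in> D" if "w \<in> D" "v \<in> V" "e \<in> edges G" "ends G e = {w, v}" for e w v
    proof -
      have "(w, v) \<in> R" using that DV by (auto simp: R_def)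
      then show ?thesis using that(1) u(2) by (auto intro: rtrancl_into_rtrancl)
    qed
    have "\<exists>e\<in>cut G X. ends G e \<subseteq> D" if X: "X \<subset> D" "X \<noteq> {}" for X
    proof (rule ccontr)
      assume no: "\<not> (\<exists>e\<in>cut G X. ends G e \<subseteq> D)"
      \<comment> \<open>Along an edge of \<open>R\<close> inside \<open>D\<close>, membership in an
        uncrossed \<open>X\<close> cannot change. All of \<open>D\<close> is linked to
        \<open>u\<close>, so \<open>X\<close> would be empty or all of \<open>D\<close>.\<close>
      have same: "w \<in> X \<longleftrightarrow> v \<in> X" if wv: "(w, v) \<in> R" "w \<in> D" for w v
      proof -
        obtain e where e: "e \<in> edges G" "ends G e = {w, v}" "v \<in> V" using wv(1) unfolding R_def by blast
        then have "ends G e \<subseteq> D" using closed[OF wv(2) e(3,1,2)] wv(2) by simp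
        then show ?thesis using no in_cut_iff[OF G e(1,2), of X] by blast
      qed
      have "w \<in> X \<longleftrightarrow> u \<in> X" if "(u, w) \<in> R\<^sup>*" for w
        using that
      proof (induction rule: rtrancl_induct)
        case (step y z)
        then show ?case using same u(2) by blast
      qed simp
      then show False using X u(2) by blast
    qed
    moreover have "k \<le> lev G U v" if "e \<in> edges G" "ends G e = {w, v}" "w \<in> D" "v \<notin> D" for e w v
    proof -
      have "v \<in> verts G" using that(1,2) G by (auto simp: finite_mgraph_def)
      moreover have "v \<notin> V" using closed that by blast
      ultimately show ?thesis by (simp add: V_def)
    qed
    moreover have "D \<noteq> {}" "D \<subseteq> verts G" "\<forall>v\<in>D. lev G U v < k" using u DV by (auto simp: V_def)
    ultimately show ?thesis unfolding level_comp_def by blast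
  qed
qed

section \<open>Levels inside a tooth\<close>

context blocks
begin

text \<open>A minimum join that avoids the boundary of the block splits into an inner and an outer
  part. The outer part meets the same conditions for every defect in the block, so inner parts can
  be interchanged. Hence inner levels differ from the levels in \<open>G\<close> by one constant,
  written additively to avoid subtraction.\<close>

lemma tooth_levels:
  assumes U: "rooted G U" and v: "v \<in> B"
    and avoid: "\<And>x. x \<in> Y v \<Longrightarrow> \<exists>J. join G (U \<triangle> {x}) J \<and> card J = lev G U x \<and> J \<inter> cut G (Y v) = {}"
  shows "x \<in> Y v \<Longrightarrow> \<exists>K. join (H v) (U \<inter> Y v \<triangle> {x}) K"
    "\<lbrakk>x \<in> Y v; y \<in> Y v\<rbrakk> \<Longrightarrow>
      lev (H v) (U \<inter> Y v) x + lev G U y = lev (H v) (U \<inter> Y v) y + lev G U x"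
proof -
  let ?E = "edges (H v)"
  obtain J where "\<forall>x\<in>Y v. join G (U \<triangle> {x}) (J x) \<and> card (J x) = lev G U x \<and> J x \<inter> cut G (Y v) = {}"
    using bchoice[of "Y v" "\<lambda>x J. join G (U \<triangle> {x}) J \<and> card J = lev G U x \<and> J \<inter> cut G (Y v) = {}"]
      avoid by blast
  then have J: "join G (U \<triangle> {x}) (J x)" "card (J x) = lev G U x" "J x \<inter> cut G (Y v) = {}" if "x \<in> Y v" for x
    using that by blast+
  have Ux: "U \<triangle> {x} \<subseteq> verts G" if "x \<in> Y v" for x
    using U that Y_sub[OF v] by (intro xor_subset) (auto simp: rooted_def)
  have JE: "J x \<subseteq> edges G" if "x \<in> Y v" for x using J(1)[OF that] by (simp add: join_def)
  have JY: "odd_verts G (J x \<inter> edges G') \<inter> Y v = {}" if "x \<in> Y v" for x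
  proof -
    have "J x \<inter> edges G' \<inter> cut G (Y v) = {}" using J(3)[OF that] by auto
    then show ?thesis using odd_verts_Y[of "J x \<inter> edges G'", OF _ v] by simp
  qed
  have UY: "(U \<triangle> {x} \<triangle> odd_verts G (J y \<inter> edges G')) \<inter> Y v = U \<inter> Y v \<triangle> {x}"
    if "x \<in> Y v" "y \<in> Y v" for x y
    using JY[OF that(2)] that(1) unfolding xor_Int by simp
  have inner: "join (H v) (U \<inter> Y v \<triangle> {x}) (J x \<inter> ?E)" if "x \<in> Y v" for x
    using J(1)[OF that] v UY[OF that that] unfolding join_iff_blocks[OF Ux[OF that] JE[OF that]] by auto
  then show "x \<in> Y v \<Longrightarrow> \<exists>K. join (H v) (U \<inter> Y v \<triangle> {x}) K" by blast
  \<comment> \<open>Outside the block the joins for \<open>x\<close> and \<open>y\<close> face the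
    same demands, so the outer part of \<open>J y\<close> is completed by any inner join for
    \<open>x\<close>.\<close>
  have swap: "lev G U x \<le> card (J y - ?E) + card K"
    if x: "x \<in> Y v" and y: "y \<in> Y v" and K: "join (H v) (U \<inter> Y v \<triangle> {x}) K" for x y K
  proof -
    let ?L = "(J y - ?E) \<union> K"
    have KE: "K \<subseteq> ?E" using K by (simp add: join_def)
    have E: "?E \<subseteq> edges G" "?E \<inter> edges G' = {}" using edges_H[OF v] edges_G' v by auto
    have LE: "?L \<subseteq> edges G" using JE[OF y] KE E(1) by auto
    have L1: "?L \<inter> edges G' = J y \<inter> edges G'" using KE E(2) by auto
    have L2: "?L \<inter> ?E = K" using KE by auto
    have L3: "?L \<inter> edges (H w) = J y \<inter> edges (H w)" if "w \<in> B" "w \<noteq> v" for w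
      using KE edges_H_disjoint[OF that(1) v that(2)] by auto
    note Jy = J(1)[OF y, unfolded join_iff_blocks[OF Ux[OF y] JE[OF y]]]
    have "join G (U \<triangle> {x}) ?L"
      unfolding join_iff_blocks[OF Ux[OF x] LE] L1
    proof (intro conjI ballI)
      fix a assume a: "a \<in> A"
      then have "a \<noteq> x" "a \<noteq> y" using A_props(3)[OF v] x y by auto
      then have "a \<in> U \<triangle> {x} \<longleftrightarrow> a \<in> U \<triangle> {y}" by simp
      also have "\<dots> \<longleftrightarrow> odd (card {e \<in> J y \<inter> edges G'. a \<in> ends G e})" using Jy a by blast
      finally show "a \<in> U \<triangle> {x} \<longleftrightarrow> odd (card {e \<in> J y \<inter> edges G'. a \<in> ends G e})" .
    next
      fix w assume w: "w \<in> B"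
      show "join (H w) ((U \<triangle> {x} \<triangle> odd_verts G (J y \<inter> edges G')) \<inter> Y w) (?L \<inter> edges (H w))"
      proof (cases "w = v")
        case True
        then show ?thesis using UY[OF x y] K L2 by simp
      next
        case False
        then have "x \<notin> Y w" "y \<notin> Y w" using Y_disj w v x y by auto
        then have "(U \<triangle> {x} \<triangle> odd_verts G (J y \<inter> edges G')) \<inter> Y w =
            (U \<triangle> {y} \<triangle> odd_verts G (J y \<inter> edges G')) \<inter> Y w"
          unfolding xor_Int by simp
        then show ?thesis using Jy w L3[OF w False] by simp
      qed
    qed
    then have "lev G U x \<le> card ?L" by (rule lev_le)
    also have "\<dots> \<le> card (J y - ?E) + card K" by (rule card_Un_le)
    finally show ?thesis .
  qed
  have split: "lev G U x = card (J x \<inter> ?E) + card (J x - ?E)" if "x \<in> Y v" for x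
    using card_Int_Diff[OF finite_join[OF fin JE[OF that]], of ?E] J(2)[OF that] by simp
  have levH: "lev (H v) (U \<inter> Y v) x = card (J x \<inter> ?E)" if x: "x \<in> Y v" for x
  proof (rule antisym)
    show "lev (H v) (U \<inter> Y v) x \<le> card (J x \<inter> ?E)" by (rule lev_le[OF inner[OF x]])
    obtain K where "join (H v) (U \<inter> Y v \<triangle> {x}) K" "card K = lev (H v) (U \<inter> Y v) x"
      unfolding lev_def using tau_attained[OF inner[OF x]] by metis
    then show "card (J x \<inter> ?E) \<le> lev (H v) (U \<inter> Y v) x"
      using swap[OF x x] split[OF x] by force
  qed
  show "lev (H v) (U \<inter> Y v) x + lev G U y = lev (H v) (U \<inter> Y v) y + lev G U x"
    if "x \<in> Y v" "y \<in> Y v"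
    using swap[OF that inner[OF that(1)]] swap[OF that(2,1) inner[OF that(2)]]
      split[OF that(1)] split[OF that(2)] levH[OF that(1)] levH[OF that(2)] by linarith
qed

end


section \<open>Every primal graft is a synthesis\<close>

lemma primal_imp_synthesis:
  fixes G :: "('a::infinite, 'e) mgraph"
  assumes graft: "graft G T" and bip: "bipartite G" and primal: "primal G T r"
  shows "\<exists>(G' :: ('a, 'e) mgraph) T' A B H S s.
    r \<in> A \<and> primal G' T' r \<and> synthesis G T G' T' A B H S s"
proof -
  define U where "U = T \<triangle> {r}"
  define M where "M = tau G T"
  define A where "A = {x \<in> verts G. lev G U x = M}"
  have fin: "finite_mgraph G" and TV: "T \<subseteq> verts G" using graft by (auto simp: graft_def)
  have rV: "r \<in> verts G" using primal by (simp add: primal_def)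
  have UV: "U \<subseteq> verts G" using TV rV unfolding U_def by (intro xor_subset) auto
  have UT: "U \<triangle> {r} = T" by (simp add: U_def)
  note pr = primal_rooted[OF graft bip primal, folded U_def M_def]
  note U = pr(1)
  have rA: "r \<in> A" using rV pr(4) by (simp add: A_def)
  obtain \<D> where finD: "finite \<D>" and compD: "\<And>D. D \<in> \<D> \<Longrightarrow> level_comp G U M D"
    and disD: "\<And>C D. \<lbrakk>C \<in> \<D>; D \<in> \<D>; C \<inter> D \<noteq> {}\<rbrakk> \<Longrightarrow> C = D"
    and covD: "\<Union>\<D> = {x \<in> verts G. lev G U x < M}"
    using level_components[OF U, of M] by blast
  \<comment> \<open>The contracted teeth need names outside \<open>G\<close>; the infinite vertex
    type supplies one for each component.\<close>
  have "infinite (UNIV - verts G)"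
    using fin by (intro Diff_infinite_finite infinite_UNIV) (simp add: finite_mgraph_def)
  then obtain B where B: "finite B" "card B = card \<D>" "B \<subseteq> UNIV - verts G"
    using infinite_arbitrarily_large by metis
  obtain f where f: "bij_betw f B \<D>" using finite_same_card_bij[OF B(1) finD B(2)] by blast
  have fD: "f v \<in> \<D>" if "v \<in> B" for v using f that by (rule bij_betw_apply)
  define H where "H v = \<lparr>verts = f v, edges = {e \<in> edges G. ends G e \<subseteq> f v}, ends = ends G\<rparr>" for v
  have HV: "verts (H v) = f v" and HE: "edges (H v) = {e \<in> edges G. ends G e \<subseteq> f v}"
    and Hends: "ends (H v) = ends G" for v
    by (simp_all add: H_def)
  have unionf: "(\<Union>v\<in>B. f v) = {x \<in> verts G. lev G U x < M}"
    using f covD unfolding bij_betw_def by simp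
  define G' where "G' = contract_graph G B (\<lambda>v. verts (H v))"
  have A_eq: "A = verts G - (\<Union>v\<in>B. verts (H v))"
    unfolding HV unionf A_def using pr(2) by force
  interpret blocks G G' A B H
  proof
    show "subgraph (H v) G" if "v \<in> B" for v
      unfolding subgraph_def HV HE Hends using level_compD(2)[OF compD[OF fD[OF that]]] by auto
    show "disjoint_family_on (\<lambda>v. verts (H v)) B"
      unfolding disjoint_family_on_def HV
    proof (intro ballI impI, rule ccontr)
      fix v w assume vw: "v \<in> B" "w \<in> B" "v \<noteq> w" "f v \<inter> f w \<noteq> {}"
      then have "f v = f w" using disD fD by blast
      then show False using vw(1-3) f by (auto simp: bij_betw_def inj_on_def)
    qed
    show "\<exists>a\<in>A. \<exists>v\<in>B. \<exists>y\<in>verts (H v). ends G e = {a, y}"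
      if e: "e \<in> edges G" "\<And>v. v \<in> B \<Longrightarrow> \<not> ends G e \<subseteq> verts (H v)" for e
    proof -
      obtain p q where pq: "ends G e = {p, q}" "p \<in> verts G" "q \<in> verts G"
        using ends_doubleton[OF fin e(1)] by metis
      have low: "\<exists>v\<in>B. x \<in> f v" if "x \<in> verts G" "x \<notin> A" for x
        using that unfolding A_eq HV by blast
      \<comment> \<open>Two vertices of \<open>A\<close> lie on the same level and hence are not
        adjacent, so the other end is below the top and in some component.\<close>
      have mixed: "\<exists>a\<in>A. \<exists>v\<in>B. \<exists>y\<in>f v. ends G e = {a, y}"
        if ay: "ends G e = {a, y}" "a \<in> A" "y \<in> verts G" for a y
      proof -
        have "lev G U a = M" using ay(2) by (simp add: A_def)
        then have "lev G U y \<noteq> M" using lev_adjacent[OF U e(1) ay(1)] by linarith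
        then have "y \<notin> A" by (simp add: A_def)
        then obtain v where "v \<in> B" "y \<in> f v" using low[OF ay(3)] by blast
        then show ?thesis using ay(1,2) by metis
      qed
      show ?thesis unfolding HV
      proof (cases "p \<in> A")
        case True
        then show "\<exists>a\<in>A. \<exists>v\<in>B. \<exists>y\<in>f v. ends G e = {a, y}" using mixed[OF pq(1) _ pq(3)] by simp
      next
        case False
        then obtain v where v: "v \<in> B" "p \<in> f v" using low pq(2) by blast
        then have "q \<notin> f v" using e(2)[OF v(1)] pq(1) by (simp add: HV)
        then have "M \<le> lev G U q" using level_compD(4)[OF compD[OF fD[OF v(1)]] e(1) pq(1) v(2)] by simp
        then have "q \<in> A" using pr(2)[OF pq(3)] pq(3) by (simp add: A_def)
        then show "\<exists>a\<in>A. \<exists>v\<in>B. \<exists>y\<in>f v. ends G e = {a, y}"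
          using mixed[of q p] pq by (simp add: insert_commute)
      qed
    qed
  qed (use fin B A_eq HV HE in \<open>auto simp: G'_def same_graph_def\<close>)
  define T' where "T' = ct T"
  have comp: "level_comp G U M (Y v)" if "v \<in> B" for v
    using compD[OF fD[OF that]] by (simp add: HV)
  have crossing: "card (J \<inter> cut G (Y v)) = (if x \<in> Y v then 0 else 1)"
    if "v \<in> B" "x \<in> verts G" "join G (U \<triangle> {x}) J" "card J = lev G U x" for v x J
    by (rule level_comp_crossing[OF U comp[OF that(1)] that(2-4)])
  \<comment> \<open>A minimum \<open>T\<close>-join is a minimum join for the defect
    \<open>r\<close>. As \<open>r\<close> lies in no tooth, it crosses the boundary of each tooth
    exactly once.\<close>
  obtain F where F: "join G T F" "card F = M"
    using lev_attained[OF U rV] pr(4) UT by metis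
  have Fcut: "card (F \<inter> cut G (Y v)) = 1" if v: "v \<in> B" for v
  proof -
    have "r \<notin> Y v" using rA A_props(3)[OF v] by auto
    then show ?thesis using crossing[OF v rV, of F] F UT pr(4) by simp
  qed
  have BT': "B \<subseteq> T'"
  proof
    fix v assume v: "v \<in> B"
    have "odd (card (Y v \<inter> T))" using cut_Y_parity[OF TV F(1) v] Fcut[OF v] by simp
    then show "v \<in> T'" unfolding T'_def using ct_iff(2)[OF v TV] by simp
  qed
  have graft': "graft G' T'"
    unfolding graft_def T'_def using finite_mgraph_G' ct_sub[OF TV] by simp
  have F': "join G' T' (F \<inter> edges G')" unfolding T'_def by (rule join_contract[OF TV F(1)])
  have cutG': "J \<inter> edges G' \<inter> cut G (Y v) = J \<inter> cut G (Y v)" if "v \<in> B" for v J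
    using cut_Y_sub[OF that] by auto
  have cardG': "card (J \<inter> edges G') = (\<Sum>v\<in>B. card (J \<inter> cut G (Y v)))" for J
    using card_G'_join[of "J \<inter> edges G'"] cutG' by (simp cong: sum.cong)
  \<comment> \<open>The contraction of \<open>F\<close> has one edge per tooth. Every join of
    \<open>G'\<close> needs at least that many, since \<open>B\<close> is contained in
    \<open>T'\<close>; so a minimum join has exactly one edge at each vertex of
    \<open>B\<close>.\<close>
  have "card (F \<inter> edges G') = card B" unfolding cardG' using Fcut by simp
  then have tau_le': "tau G' T' \<le> card B" using tau_le[OF F'] by simp
  have comb: "comb G' T' A B"
    unfolding comb_def
  proof (intro conjI allI impI ballI)
    fix K v assume K: "minimum_join G' T' K" and v: "v \<in> B"
    have K': "join G' T' K" "card K \<le> card B" "K \<subseteq> edges G'"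
      using K tau_le' by (auto simp: minimum_join_iff join_def)
    have "card (K \<inter> cut G (Y v)) = 1"
    proof (rule sum_odd_eq_one[OF finB _ _ v])
      show "odd (card (K \<inter> cut G (Y w)))" if "w \<in> B" for w
        using K'(1) BT' that unfolding join_G'_iff[OF K'(3)] by blast
      show "(\<Sum>w\<in>B. card (K \<inter> cut G (Y w))) \<le> card B + 1"
        using card_G'_join[OF K'(3)] K'(2) by simp
    qed
    then show "card (cut G' {v} \<inter> K) = 1" unfolding cut_G'_single[OF v] by (simp add: Int_commute)
  qed (rule graft' colour_classes_G')+
  obtain F0 where "minimum_join G' T' F0" using tau_attained[OF F'] minimum_join_iff by metis
  then have tau': "tau G' T' = card B" using comb_tau(1)[OF comb] by blast
  have cr: "contract_vertex B Y r = r" using rA A_eq by (intro contract_vertex_out) auto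
  have primal': "primal G' T' r"
    unfolding primal_iff[OF graft'] tau'
  proof (intro conjI ballI)
    show "r \<in> verts G'" using rA verts_G' by auto
    fix x' assume "x' \<in> verts G'"
    then consider "x' \<in> A" | "x' \<in> B" using verts_G' by auto
    then obtain x where x: "x \<in> verts G" "contract_vertex B Y x = x'"
    proof cases
      case 1
      then show thesis using that[of x'] contract_vertex_out[of x' Y B] A_eq by auto
    next
      case 2
      then obtain x where "x \<in> Y x'" using level_compD(1)[OF comp] by blast
      then show thesis using that[of x] contract_vertex_in[OF disj 2] Y_sub[OF 2] by auto
    qed
    obtain J where J: "join G (U \<triangle> {x}) J" "card J = lev G U x"
      using lev_attained[OF U x(1)] by metis
    have "U \<triangle> {x} \<subseteq> verts G" using UV x(1) by (intro xor_subset) auto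
    then have "join G' (ct (U \<triangle> {x})) (J \<inter> edges G')" using J(1) by (rule join_contract)
    moreover have "ct (U \<triangle> {x}) = T' \<triangle> {r} \<triangle> {x'}"
      unfolding ct_xor[OF UV x(1)] x(2) unfolding U_def ct_xor[OF TV rV] cr T'_def ..
    \<comment> \<open>By \<open>crossing\<close>, a minimum join for \<open>x\<close> meets each
      tooth boundary at most once, so its contraction does not exceed the minimum size
      \<open>card B\<close> of a join of the comb.\<close>
    moreover have "card (J \<inter> edges G') \<le> card B"
    proof -
      have "card (J \<inter> edges G') \<le> (\<Sum>v\<in>B. 1)"
        unfolding cardG' using crossing[OF _ x(1) J] by (intro sum_mono) simp
      then show ?thesis by simp
    qed
    ultimately show "\<exists>J. join G' (T' \<triangle> {r} \<triangle> {x'}) J \<and> card J \<le> card B" by auto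
  qed
  \<comment> \<open>\<open>M - 1\<close> is the highest level possible in a tooth, and the root of a
    tooth must lie on top. The inner end of the crossing edge of \<open>F\<close> serves, being
    adjacent to level \<open>M\<close>.\<close>
  have "\<forall>v\<in>B. \<exists>z. z \<in> Y v \<and> lev G U z = M - 1"
  proof
    fix v assume v: "v \<in> B"
    obtain e where e: "F \<inter> cut G (Y v) = {e}" using Fcut[OF v] by (rule card_1_singletonE)
    then have eC: "e \<in> cut G (Y v)" by auto
    then have eG': "e \<in> edges G'" using cut_Y_sub[OF v] by auto
    then have eE: "e \<in> edges G" using edges_G'_sub by auto
    obtain a w z where az: "a \<in> A" "w \<in> B" "z \<in> Y w" "ends G e = {a, z}" using edge_G'E[OF eG'] by metis
    have z: "z \<in> Y v" using eC in_cut_iff[OF fin eE az(4)] A_props(3)[OF v] az(1) by auto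
    have "lev G U z < M" by (rule level_compD(3)[OF comp[OF v] z])
    then have "lev G U z = M - 1" using lev_adjacent[OF U eE az(4)] az(1) by (auto simp: A_def)
    then show "\<exists>z. z \<in> Y v \<and> lev G U z = M - 1" using z by blast
  qed
  from bchoice[OF this] obtain s where s: "\<And>v. v \<in> B \<Longrightarrow> s v \<in> Y v" "\<And>v. v \<in> B \<Longrightarrow> lev G U (s v) = M - 1"
    by blast
  \<comment> \<open>The root is toggled so that it cancels: \<open>S v \<triangle> {s v}\<close> is
    \<open>T \<inter> Y v\<close>, and for a tooth this is also \<open>U \<inter> Y v\<close>, since
    \<open>r\<close> lies outside.\<close>
  define S where "S v = (T \<inter> Y v) \<triangle> {s v}" for v
  have tooth: "tooth_graft (H v) (S v) (s v)"
    and cuts: "cut G (Y v) = edges_between G A (root_level (H v) (S v) (s v))" if v: "v \<in> B" for v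
  proof -
    have UY: "U \<inter> Y v = T \<inter> Y v" using rA A_props(3)[OF v] by (auto simp: U_def)
    have avoid: "\<exists>J. join G (U \<triangle> {x}) J \<and> card J = lev G U x \<and> J \<inter> cut G (Y v) = {}" if x: "x \<in> Y v" for x
    proof -
      have xV: "x \<in> verts G" using x Y_sub[OF v] by auto
      obtain J where J: "join G (U \<triangle> {x}) J" "card J = lev G U x" using lev_attained[OF U xV] by metis
      have "finite J" using J(1) finite_join[OF fin] by (simp add: join_def)
      then have "J \<inter> cut G (Y v) = {}" using crossing[OF v xV J] x by simp
      then show ?thesis using J by blast
    qed
    have levels: "\<exists>K. join (H v) (T \<inter> Y v \<triangle> {x}) K"
      "y \<in> Y v \<Longrightarrow> lev (H v) (T \<inter> Y v) x + lev G U y = lev (H v) (T \<inter> Y v) y + lev G U x"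
      if "x \<in> Y v" for x y
      using tooth_levels(1)[OF U v _ that] tooth_levels(2)[OF U v _ that] avoid unfolding UY by blast+
    have top: "lev G U x \<le> M - 1" if "x \<in> Y v" for x
      using level_compD(3)[OF comp[OF v] that] by simp
    have TS: "S v \<triangle> {s v} = T \<inter> Y v" by (simp add: S_def)
    have tauS: "tau (H v) (S v) = lev (H v) (T \<inter> Y v) (s v)" by (simp add: S_def lev_def)
    have "finite_mgraph (H v)"
      using fin fin_sets(3)[OF v] unfolding finite_mgraph_def Hends HE HV by auto
    then have gr: "graft (H v) (S v)"
      using s(1)[OF v] unfolding graft_def S_def by (auto intro!: xor_subset)
    obtain C D where CD: "colour_classes (H v) C D" "s v \<in> C"
    proof -
      obtain C D where *: "colour_classes G C D" using bip unfolding bipartite_def by blast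
      have CDH: "colour_classes (H v) (C \<inter> Y v) (D \<inter> Y v)" if CD: "colour_classes G C D" for C D
      proof (rule colour_classesI)
        show "C \<inter> Y v \<union> D \<inter> Y v = Y v" "C \<inter> Y v \<inter> (D \<inter> Y v) = {}"
          using CD Y_sub[OF v] unfolding colour_classes_def by blast+
        fix e assume e: "e \<in> edges (H v)"
        then have "e \<in> edges G" "ends G e \<subseteq> Y v" unfolding HE HV by auto
        moreover then obtain a b where "a \<in> C" "b \<in> D" "ends G e = {a, b}"
          using CD unfolding colour_classes_def by metis
        ultimately show "\<exists>a\<in>C \<inter> Y v. \<exists>b\<in>D \<inter> Y v. ends (H v) e = {a, b}"
          unfolding Hends by blast
      qed
      have "s v \<in> C \<or> s v \<in> D"
        using * s(1)[OF v] Y_sub[OF v] unfolding colour_classes_def by blast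
      then show thesis
        using that CDH[OF *] CDH[OF colour_classes_swap[OF *]] s(1)[OF v] by blast
    qed
    have prH: "primal (H v) (S v) (s v)"
      unfolding primal_iff[OF gr] TS
    proof (intro conjI ballI s(1)[OF v])
      fix x assume x: "x \<in> Y v"
      obtain K where "join (H v) (T \<inter> Y v \<triangle> {x}) K" "card K = lev (H v) (T \<inter> Y v) x"
        using levels(1)[OF x] unfolding lev_def by (metis tau_attained)
      moreover have "lev (H v) (T \<inter> Y v) x \<le> tau (H v) (S v)"
        using levels(2)[OF x s(1)[OF v]] top[OF x] s(2)[OF v] tauS by linarith
      ultimately show "\<exists>K. join (H v) (T \<inter> Y v \<triangle> {x}) K \<and> card K \<le> tau (H v) (S v)" by auto
    qed
    have bipH: "bipartite (H v)" using CD(1) unfolding bipartite_def by blast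
    show "tooth_graft (H v) (S v) (s v)"
      unfolding tooth_graft_def using gr CD prH by blast
    \<comment> \<open>By \<open>levels\<close>, inner levels are the levels of \<open>G\<close>
      shifted by a constant, so the root level consists of the vertices of the tooth at level
      \<open>M - 1\<close>, the only ones that can be adjacent to \<open>A\<close>.\<close>
    have rl: "root_level (H v) (S v) (s v) = {x \<in> Y v. lev G U x = M - 1}"
      unfolding primal_rooted(3)[OF gr bipH prH] TS tauS
      using levels(2)[OF _ s(1)[OF v]] s(2)[OF v] by (intro Collect_cong conj_cong refl) fastforce
    show "cut G (Y v) = edges_between G A (root_level (H v) (S v) (s v))"
      unfolding rl
    proof (intro set_eqI iffI)
      fix e assume e: "e \<in> cut G (Y v)"
      then have eG': "e \<in> edges G'" using cut_Y_sub[OF v] by auto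
      then have eE: "e \<in> edges G" using edges_G'_sub by auto
      obtain a w z where az: "a \<in> A" "w \<in> B" "z \<in> Y w" "ends G e = {a, z}" using edge_G'E[OF eG'] by metis
      have z: "z \<in> Y v" using e in_cut_iff[OF fin eE az(4)] A_props(3)[OF v] az(1) by auto
      have "lev G U z = M - 1"
        using level_compD(3)[OF comp[OF v] z] lev_adjacent[OF U eE az(4)] az(1) by (auto simp: A_def)
      then show "e \<in> edges_between G A {x \<in> Y v. lev G U x = M - 1}"
        unfolding edges_between_def using eE az z by blast
    next
      fix e assume "e \<in> edges_between G A {x \<in> Y v. lev G U x = M - 1}"
      then obtain a z where "e \<in> edges G" "a \<in> A" "z \<in> Y v" "ends G e = {a, z}"
        unfolding edges_between_def by blast
      then show "e \<in> cut G (Y v)" using in_cut_iff[OF fin] A_props(3)[OF v] by blast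
    qed
  qed
  have TS: "T \<inter> Y v = sym_diff (S v) {s v}" for v
    by (simp add: S_def flip: xor_set_def)
  have new': "Y v \<inter> verts G' = {}" if "v \<in> B" for v
    using verts_G' A_props(3)[OF that] Y_sub[OF that] new by auto
  have "synthesis G T G' T' A B H S s"
    unfolding synthesis_def
    by (intro conjI ballI; (rule comb disj graft bip new same T'_def[symmetric] TS |
        (rule tooth sub edges_H cuts new', assumption)))
  then show ?thesis using rA primal' by blast
qed

text \<open>The definition of a synthesis does not list the kinds of edges, so
  \<open>edge_cases\<close> has to be recovered from the comb. Its colour classes give an edge
  outside the teeth one end that maps to \<open>A\<close> and one that maps to \<open>B\<close>; as
  the names in \<open>B\<close> are new, these ends lie in \<open>A\<close> and in a tooth.\<close>

lemma synthesis_imp_primal: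
  assumes syn: "synthesis G T G' T' A B H S s" and r: "r \<in> A" and primal': "primal G' T' r"
  shows "primal G T r"
proof -
  let ?Y = "\<lambda>v. verts (H v)"
  have comb: "comb G' T' A B" and tooth: "\<And>v. v \<in> B \<Longrightarrow> tooth_graft (H v) (S v) (s v)"
    and disj: "disjoint_family_on ?Y B" and graft: "graft G T"
    and sub: "\<And>v. v \<in> B \<Longrightarrow> subgraph (H v) G"
    and edges_H: "\<And>v. v \<in> B \<Longrightarrow> edges (H v) = {e \<in> edges G. ends G e \<subseteq> ?Y v}"
    and TY: "\<And>v. v \<in> B \<Longrightarrow> T \<inter> ?Y v = S v \<triangle> {s v}"
    and new: "B \<inter> verts G = {}" and same: "same_graph (contract_graph G B ?Y) G'"
    and ct: "contract_terminals T B ?Y = T'"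
    and cuts: "\<And>v. v \<in> B \<Longrightarrow> cut G (?Y v) = edges_between G A (root_level (H v) (S v) (s v))"
    using syn by (simp_all add: synthesis_def xor_set_def)
  have col: "colour_classes G' A B" and fin': "finite_mgraph G'"
    using comb unfolding comb_def graft_def by blast+
  have V': "verts G' = (verts G - (\<Union>v\<in>B. ?Y v)) \<union> B"
    using same by (simp add: same_graph_def contract_graph_def)
  have AB: "A \<union> B = verts G'" "A \<inter> B = {}" using col by (auto simp: colour_classes_def)
  have fin: "finite_mgraph G" using graft by (simp add: graft_def)
  interpret blocks G G' A B H
  proof
    show "finite B" using fin' AB(1) by (auto simp: finite_mgraph_def intro: finite_subset)
    show "A = verts G - (\<Union>v\<in>B. ?Y v)" using AB V' new by blast
    then have A_eq: "A = verts G - (\<Union>v\<in>B. ?Y v)" .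
    show "\<exists>a\<in>A. \<exists>v\<in>B. \<exists>y\<in>?Y v. ends G e = {a, y}"
      if e: "e \<in> edges G" "\<And>v. v \<in> B \<Longrightarrow> \<not> ends G e \<subseteq> ?Y v" for e
    proof -
      let ?c = "contract_vertex B ?Y"
      have eC: "e \<in> edges (contract_graph G B ?Y)" using e by (simp add: contract_graph_def)
      then have eG': "e \<in> edges G'" and "ends G' e = ends (contract_graph G B ?Y) e"
        using same unfolding same_graph_def by auto
      then have img: "ends G' e = ?c ` ends G e" by (simp add: contract_graph_def)
      obtain a b where ab: "a \<in> A" "b \<in> B" "ends G' e = {a, b}"
        using col eG' unfolding colour_classes_def by metis
      obtain p q where pq: "ends G e = {p, q}" "p \<in> verts G" "q \<in> verts G"
        using ends_doubleton[OF fin e(1)] by metis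
      have toA: "x \<in> A" if x: "x \<in> verts G" "?c x = a" for x
      proof (rule ccontr)
        assume "x \<notin> A"
        then obtain v where "v \<in> B" "x \<in> ?Y v" using A_eq x(1) by blast
        then have "?c x = v" by (rule contract_vertex_in[OF disj])
        then show False using x(2) ab(1) \<open>v \<in> B\<close> AB(2) by blast
      qed
      have toB: "x \<in> ?Y b" if x: "x \<in> verts G" "?c x = b" for x
      proof (cases "x \<in> A")
        case True
        then have "?c x = x" using A_eq by (intro contract_vertex_out) blast
        \<comment> \<open>A vertex of \<open>A\<close> that maps to \<open>b\<close> would be
          \<open>b\<close> itself, which is not a vertex of \<open>G\<close>.\<close>
        then have "x = b" using x(2) by simp
        then show ?thesis using x(1) new ab(2) by blast
      next
        case False
        then obtain v where "v \<in> B" "x \<in> ?Y v" using A_eq x(1) by blast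
        moreover then have "?c x = v" by (rule contract_vertex_in[OF disj])
        ultimately show ?thesis using x(2) by simp
      qed
      have "{?c p, ?c q} = {a, b}" using img ab(3) pq(1) by simp
      then have "?c p = a \<and> ?c q = b \<or> ?c q = a \<and> ?c p = b" unfolding doubleton_eq_iff by blast
      then show ?thesis
      proof
        assume "?c p = a \<and> ?c q = b"
        then show ?thesis using toA[of p] toB[of q] pq ab(2) by metis
      next
        assume "?c q = a \<and> ?c p = b"
        then show ?thesis using toA[of q] toB[of p] pq ab(2) by (metis insert_commute)
      qed
    qed
  qed (rule fin disj new same | (rule sub edges_H, assumption))+
  have "T \<subseteq> verts G" using graft by (simp add: graft_def)
  then show ?thesis using comb primal' r tooth TY ct cuts by (rule synthesis_primal)
qed

theorem theorem8p1:
  fixes G :: "('a::infinite, 'e) mgraph" and T :: "'a set" and r :: 'a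
  assumes "graft G T" and "bipartite G" and "r \<in> verts G"
  shows "primal G T r \<longleftrightarrow>
    (\<exists>(G' :: ('a, 'e) mgraph) T' A B H S s.
       r \<in> A \<and> primal G' T' r \<and> synthesis G T G' T' A B H S s)"
  using primal_imp_synthesis[OF assms(1,2)] synthesis_imp_primal by metis

end
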